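(* Let $m,n\in\mathbb{N}_0$, $\mu\in(-1/2,\infty)\setminus\{0\}$, and $\rho\in\{z\in\mathbb{C}:0<|z|<1\}\setminus(-1,0]$. With $R=\sqrt{1+\rho^2-2\rho x}$ and $\zeta_+=(1+\rho)/R$, $$\int_{-1}^1\frac{(1-x^2)^{\mu-1/2}}{R^{2\mu+m}}\,C_m^\mu(\zeta_+)\,C_n^\mu(x)\,dx=\frac{2^{2-2\mu}\,\pi\,\Gamma(2\mu+n)\,\Gamma(2\mu+2n+m)}{m!\,n!\,\Gamma^2(\mu)\,\rho^\mu(1-\rho)^m}\,P_{-m}^{-2n-2\mu}\!\left(\frac{1+\rho}{1-\rho}\right).$$
   Context: $\mathbb{N}_0=\{0,1,2,\dots\}$. $(z)_n=\prod_{i=1}^n(z+i-1)$ is the Pochhammer symbol. ${}_2F_1$ is the Gauss hypergeometric function, analytically continued to $\mathbb{C}\setminus[1,\infty)$. The Gegenbauer polynomials are $C_n^\mu(z)=\frac{(2\mu)_n}{n!}\,{}_2F_1(-n,n+2\mu;\mu+\frac12;\frac{1-z}{2})$. The associated Legendre function of the first kind on $\mathbb{C}\setminus(-\infty,1]$ is $P_\nu^\mu(z)=\frac{1}{\Gamma(1-\mu)}\left(\frac{z+1}{z-1}\right)^{\mu/2}{}_2F_1(-\nu,\nu+1;1-\mu;\frac{1-z}{2})$. All powers and square roots are principal. *)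

theory Defs
  imports "HOL-Analysis.Analysis"
begin

(* Gauss hypergeometric function. If a or b is in {0,-1,-2,...}, the series terminates and defines
   a polynomial on all of the complex plane. Otherwise the value at z is that of the holomorphic
   continuation of the series from the unit disc to the plane cut along [1, oo), which is unique
   because the cut plane is connected; for z on the cut no value is specified.
   The parameter c must not be in {0,-1,-2,...}. *)
definition hyp2F1 :: "complex \<Rightarrow> complex \<Rightarrow> complex \<Rightarrow> complex \<Rightarrow> complex" where
  "hyp2F1 a b c z =
     (if a \<in> \<int>\<^sub>\<le>\<^sub>0 \<or> b \<in> \<int>\<^sub>\<le>\<^sub>0 then eval_fps (fps_hypergeo [a, b] [c] 1) z
      else (THE w. \<exists>f. f holomorphic_on (- complex_of_real ` {1..}) \<and>
                       (\<forall>u\<in>ball 0 1. f u = eval_fps (fps_hypergeo [a, b] [c] 1) u) \<and>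
                       z \<notin> complex_of_real ` {1..} \<and> w = f z))"

definition gegenbauer :: "nat \<Rightarrow> complex \<Rightarrow> complex \<Rightarrow> complex" where
  "gegenbauer n \<mu> z =
     pochhammer (2 * \<mu>) n / fact n *
     hyp2F1 (- of_nat n) (of_nat n + 2 * \<mu>) (\<mu> + 1 / 2) ((1 - z) / 2)"

(* Associated Legendre function of the first kind for z outside (-oo, 1], with principal powers.
   The formula is meaningful as it stands only if 1 - \<mu> is not in {0,-1,-2,...}. *)
definition legendre_P :: "complex \<Rightarrow> complex \<Rightarrow> complex \<Rightarrow> complex" where
  "legendre_P \<nu> \<mu> z =
     1 / Gamma (1 - \<mu>) * ((z + 1) / (z - 1)) powr (\<mu> / 2) *
     hyp2F1 (- \<nu>) (\<nu> + 1) (1 - \<mu>) ((1 - z) / 2)"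

end

theory Submission
  imports Defs "HOL-Complex_Analysis.Complex_Analysis"
begin

text \<open>
  Write \<open>S = R\<^sup>2 = 1 + \<rho>\<^sup>2 - 2 \<rho> x\<close>.  The explicit formula for \<open>C_m\<^sup>\<mu>\<close> in powers of its argument
  (\<open>gegenbauer_explicit\<close>) involves only the powers \<open>2 j - m\<close>, so that
  \<open>R powr (- 2 \<mu> - m) * C_m((1 + \<rho>) / R)\<close> is a finite combination of the functions
  \<open>(1 + \<rho>) ^ (2 j - m) * S powr (- \<mu> - j)\<close> (\<open>gegenbauer_over_powr\<close>): the square root disappears.
  Since \<open>S = (1 - \<rho> e) (1 - \<rho> e')\<close> with \<open>e, e' = x \<plusminus> i sqrt (1 - x\<^sup>2)\<close> on the unit circle, both factors
  have positive real part, and multiplying two binomial series shows that each integral is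
  holomorphic in the unit disc (\<open>holomorphic_kernel_integral\<close>).  Once the powers of \<open>\<rho>\<close>
  are collected, the right-hand side is a constant times \<open>\<rho> ^ n\<close> times a polynomial in \<open>\<rho> / (1 - \<rho>)\<close>
  divided by \<open>(1 - \<rho>) ^ m\<close>, because one of the upper parameters \<open>m\<close> and \<open>1 - m\<close> of its hypergeometric
  function is a nonpositive integer.  By the identity theorem it is
  enough to compare both sides for small positive real \<open>\<rho>\<close>.

  For real \<open>\<rho>\<close> in \<open>(0, 1)\<close> the relation \<open>S = (1 + \<rho>)\<^sup>2 (1 - y)\<close> with \<open>y = 2 \<rho> (1 + x) / (1 + \<rho>)\<^sup>2\<close> in
  \<open>[0, 1)\<close> turns the integrand into a power series in \<open>y\<close> (\<open>gegenbauer_generating_sums\<close>).  The moments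
  of \<open>(1 + x) ^ j\<close> against \<open>(1 - x\<^sup>2) powr (\<mu> - 1/2) * C_n\<close> are Beta integrals summed by Vandermonde's
  identity (\<open>gegenbauer_shifted_moment\<close>) and vanish for \<open>j < n\<close>.  Hence, with \<open>a = 2 \<mu> + 2 n + m\<close> and
  \<open>c = 2 \<mu> + 2 n + 1\<close>, the integral is a constant times
  \<open>\<rho> ^ n (1 + \<rho>) powr (- a) F(a/2, (a+1)/2; c; 4 \<rho> / (1 + \<rho>)\<^sup>2)\<close>, where \<open>F\<close> is the Gauss series.
  The quadratic transformation (\<open>quadratic_transformation\<close>) makes this \<open>\<rho> ^ n F(a, m; c; \<rho>)\<close>, and the
  Pfaff transformation (\<open>pfaff_sums\<close>) gives \<open>\<rho> ^ n (1 - \<rho>) ^ (-m) F(m, 1 - m; c; - \<rho> / (1 - \<rho>))\<close>,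
  which is the Legendre function on the right.  The constants agree by the duplication formula
  (\<open>moment_constant_eq\<close>).
\<close>

unbundle no vec_syntax

section \<open>Binomial series of formal power series\<close>

lemma fps_compose_mult_nth:
  fixes E G H :: "'a::field fps"
  assumes "G $ 0 = 0"
  shows "((E oo G) * H) $ n = (\<Sum>i\<le>n. E $ i * (G ^ i * H) $ n)"
proof -
  have ext: "(E oo G) $ l = (\<Sum>i\<le>n. E $ i * (G ^ i) $ l)" if "l \<le> n" for l
  proof -
    have "(E oo G) $ l = (\<Sum>i\<in>{0..l}. E $ i * (G ^ i) $ l)"
      by (simp add: fps_compose_nth)
    also have "\<dots> = (\<Sum>i\<le>n. E $ i * (G ^ i) $ l)"
      using that assms
      by (intro sum.mono_neutral_left) (auto simp: startsby_zero_power_prefix)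
    finally show ?thesis .
  qed
  have "((E oo G) * H) $ n = (\<Sum>l\<le>n. (\<Sum>i\<le>n. E $ i * (G ^ i) $ l) * H $ (n - l))"
    by (simp add: fps_mult_nth ext atMost_atLeast0)
  also have "\<dots> = (\<Sum>l\<le>n. \<Sum>i\<le>n. E $ i * ((G ^ i) $ l * H $ (n - l)))"
    by (simp add: sum_distrib_left sum_distrib_right mult_ac)
  also have "\<dots> = (\<Sum>i\<le>n. \<Sum>l\<le>n. E $ i * ((G ^ i) $ l * H $ (n - l)))"
    by (rule sum.swap)
  also have "\<dots> = (\<Sum>i\<le>n. E $ i * (G ^ i * H) $ n)"
    by (simp add: fps_mult_nth sum_distrib_left atMost_atLeast0)
  finally show ?thesis .
qed

lemma fps_binomial_compose_deriv:
  fixes W :: "'a::field_char_0 fps"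
  assumes "W $ 0 = 0"
  shows "fps_deriv (fps_binomial a oo W) * (1 + W) = fps_const a * fps_deriv W * (fps_binomial a oo W)"
proof -
  have "fps_deriv (fps_binomial a) * (1 + fps_X) = fps_const a * fps_binomial a"
    by (simp add: fps_binomial_deriv fps_divide_unit inverse_mult_eq_1 mult.assoc)
  then have "(fps_deriv (fps_binomial a) * (1 + fps_X)) oo W = (fps_const a * fps_binomial a) oo W"
    by simp
  then have "(fps_deriv (fps_binomial a) oo W) * (1 + W) = fps_const a * (fps_binomial a oo W)"
    using assms by (simp add: fps_compose_mult_distrib fps_compose_add_distrib)
  then show ?thesis
    using assms by (simp add: fps_compose_deriv mult_ac)
qed

text \<open>
  The series \<open>(1 + W) ^ a\<close> is determined by its linear differential equation: the product of a
  solution with \<open>(1 + W) ^ (-a)\<close> has derivative zero.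
\<close>

lemma fps_binomial_compose_unique:
  fixes W :: "'a::field_char_0 fps"
  assumes W: "W $ 0 = 0" and f0: "f $ 0 = 1"
    and f: "fps_deriv f * (1 + W) = fps_const a * fps_deriv W * f"
  shows "f = fps_binomial a oo W"
proof -
  define g where "g = fps_binomial (-a) oo W"
  have g: "fps_deriv g * (1 + W) = - (fps_const a * fps_deriv W * g)"
    unfolding g_def using fps_binomial_compose_deriv[OF W, of "-a"]
    by (metis fps_const_neg minus_mult_left)
  have "fps_deriv (f * g) * (1 + W) = (fps_deriv f * (1 + W)) * g + f * (fps_deriv g * (1 + W))"
    by (simp add: algebra_simps)
  also have "\<dots> = 0"
    unfolding f g by (simp add: algebra_simps)
  finally have "fps_deriv (f * g) = 0 \<or> 1 + W = 0" by simp
  moreover have "1 + W \<noteq> 0" using W by (metis add.right_neutral fps_add_nth fps_one_nth fps_zero_nth zero_neq_one)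
  ultimately have "fps_deriv (f * g) = 0" by blast
  then have "f * g = fps_const ((f * g) $ 0)" by (rule iffD1[OF fps_deriv_eq_0_iff])
  moreover have "g $ 0 = 1" by (simp add: g_def)
  ultimately have fg: "f * g = 1" using f0 by simp
  have "(fps_binomial a oo W) * g = (fps_binomial (a + -a)) oo W"
    unfolding g_def fps_binomial_add_mult using W by (simp add: fps_compose_mult_distrib)
  then have "(fps_binomial a oo W) * g = 1" by simp
  with fg show ?thesis by (metis mult.commute mult.left_commute mult.right_neutral)
qed

text \<open>
  The law \<open>(1 + U) ^ a (1 + V) ^ a = ((1 + U) (1 + V)) ^ a\<close> for formal power series, for an arbitrary
  exponent: both sides solve the same differential equation.
\<close>

lemma fps_binomial_compose_mult:
  fixes U V :: "'a::field_char_0 fps"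
  assumes "U $ 0 = 0" "V $ 0 = 0"
  shows "(fps_binomial a oo U) * (fps_binomial a oo V) = fps_binomial a oo (U + V + U * V)"
proof (rule fps_binomial_compose_unique)
  let ?f = "fps_binomial a oo U" and ?g = "fps_binomial a oo V"
  have "fps_deriv (?f * ?g) * (1 + (U + V + U * V)) =
      (fps_deriv ?f * (1 + U)) * ?g * (1 + V) + ?f * (fps_deriv ?g * (1 + V)) * (1 + U)"
    by (simp add: algebra_simps)
  also have "\<dots> = fps_const a * fps_deriv (U + V + U * V) * (?f * ?g)"
    unfolding fps_binomial_compose_deriv[OF assms(1)] fps_binomial_compose_deriv[OF assms(2)]
    by (simp add: algebra_simps)
  finally show "fps_deriv (?f * ?g) * (1 + (U + V + U * V)) =
      fps_const a * fps_deriv (U + V + U * V) * (?f * ?g)" .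
qed (use assms in simp_all)

text \<open>
  The substitution \<open>X \<mapsto> c X / (1 + X)\<^sup>2\<close> underlies both the passage between the two forms of the
  Gegenbauer polynomials and the quadratic transformation of the hypergeometric series; in both
  cases the coefficients are read off from this formula.
\<close>

lemma quadratic_compose_nth:
  fixes E :: "'a::field_char_0 fps"
  shows "((E oo (fps_const c * fps_X * fps_binomial (-2))) * fps_binomial (-a)) $ n =
    (\<Sum>i\<le>n. E $ i * c ^ i * ((- a - 2 * of_nat i) gchoose (n - i)))"
proof -
  have "((fps_const c * fps_X * fps_binomial (-2)) ^ i * fps_binomial (-a)) $ n =
      c ^ i * ((- a - 2 * of_nat i) gchoose (n - i))" if "i \<le> n" for i
  proof -
    have exponent: "of_nat i * (-2) + (-a) = - a - 2 * of_nat i"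
      by simp
    have "(fps_const c * fps_X * fps_binomial (-2)) ^ i * fps_binomial (-a) =
       fps_const (c ^ i) * (fps_X ^ i * (fps_binomial (of_nat i * (-2)) * fps_binomial (-a)))"
      by (simp only: power_mult_distrib fps_binomial_power mult.assoc fps_const_power)
    also have "\<dots> = fps_const (c ^ i) * (fps_X ^ i * fps_binomial (- a - 2 * of_nat i))"
      by (simp only: fps_binomial_add_mult[symmetric] exponent)
    finally have "(fps_const c * fps_X * fps_binomial (-2)) ^ i * fps_binomial (-a) =
       fps_const (c ^ i) * (fps_X ^ i * fps_binomial (- a - 2 * of_nat i))" .
    then show ?thesis using that by (simp add: fps_X_power_mult_nth)
  qed
  then show ?thesis by (subst fps_compose_mult_nth) (auto simp: mult.assoc)
qed

section \<open>The explicit form of the Gegenbauer polynomials\<close>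

lemma hyp2F1_terminating:
  "hyp2F1 (- of_nat n) b c z =
    (\<Sum>k\<le>n. pochhammer (- of_nat n) k * pochhammer b k / (pochhammer c k * fact k) * z ^ k)"
proof -
  have "hyp2F1 (- of_nat n) b c z =
      (\<Sum>k. fps_nth (fps_hypergeo [- of_nat n, b] [c] 1) k * z ^ k)"
    by (simp add: hyp2F1_def eval_fps_def)
  also have "\<dots> = (\<Sum>k\<le>n. fps_nth (fps_hypergeo [- of_nat n, b] [c] 1) k * z ^ k)"
    by (rule suminf_finite) (auto simp: pochhammer_of_nat_eq_0_iff)
  finally show ?thesis by simp
qed

lemma hyp2F1_terminating':
  "hyp2F1 b (- of_nat n) c z =
    (\<Sum>k\<le>n. pochhammer b k * pochhammer (- of_nat n) k / (pochhammer c k * fact k) * z ^ k)"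
proof -
  have "hyp2F1 b (- of_nat n) c z =
      (\<Sum>k. fps_nth (fps_hypergeo [b, - of_nat n] [c] 1) k * z ^ k)"
    by (simp add: hyp2F1_def eval_fps_def)
  also have "\<dots> = (\<Sum>k\<le>n. fps_nth (fps_hypergeo [b, - of_nat n] [c] 1) k * z ^ k)"
    by (rule suminf_finite) (auto simp: pochhammer_of_nat_eq_0_iff)
  finally show ?thesis by simp
qed

lemma fps_linear_power_nth:
  "((fps_const c + fps_X) ^ j) $ l = of_nat (j choose l) * (c :: 'a :: field_char_0) ^ (j - l)"
proof -
  have "((fps_X + fps_const c) ^ j) $ l =
      (\<Sum>k\<le>j. (fps_const (of_nat (j choose k)) * (fps_X ^ k * fps_const (c ^ (j - k)))) $ l)"
    by (simp only: binomial_ring fps_sum_nth fps_of_nat[symmetric] fps_const_power mult.assoc)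
  also have "\<dots> = (\<Sum>k\<le>j. if l = k then of_nat (j choose k) * c ^ (j - k) else 0)"
    by (intro sum.cong) (auto simp: fps_X_power_mult_nth)
  also have "\<dots> = of_nat (j choose l) * c ^ (j - l)"
    by (auto simp: sum.delta)
  finally show ?thesis by (simp add: add.commute)
qed

lemma fps_binomial_compose_quadratic_nth:
  fixes c :: "'a :: field_char_0"
  shows "(fps_binomial (-a) oo (fps_const c * fps_X + fps_X ^ 2)) $ n =
    (\<Sum>j\<le>n. (-1) ^ j * pochhammer a j / fact j * of_nat (j choose (n - j)) * c ^ (2 * j - n))"
proof -
  have eq: "fps_const c * fps_X + fps_X ^ 2 = fps_X * (fps_const c + fps_X :: 'a fps)"
    by (simp add: algebra_simps power2_eq_square)
  have pw: "((fps_const c * fps_X + fps_X ^ 2) ^ j) $ n = of_nat (j choose (n - j)) * c ^ (2 * j - n)"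
    if "j \<le> n" for j
    using that unfolding eq power_mult_distrib
    by (simp add: fps_X_power_mult_nth fps_linear_power_nth mult_2)
  show ?thesis
    by (simp add: fps_compose_nth pw atMost_atLeast0 gbinomial_pochhammer mult.assoc)
qed

text \<open>
  This is \<open>1 + 2 z X + X\<^sup>2 = (1 + X)\<^sup>2 (1 + 2 (z - 1) X / (1 + X)\<^sup>2)\<close> raised to the power \<open>-a\<close>.
\<close>

lemma fps_binomial_compose_quadratic_shift:
  fixes z :: "'a :: field_char_0"
  shows "fps_binomial (-a) oo (fps_const (2 * z) * fps_X + fps_X ^ 2) =
    (fps_binomial (-a) oo (fps_const (2 * (z - 1)) * fps_X * fps_binomial (-2))) * fps_binomial (-(2 * a))"
proof -
  let ?V = "fps_const (2 * (z - 1)) * fps_X * fps_binomial (-2) :: 'a fps"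
  let ?Q = "fps_X + fps_X + fps_X * fps_X :: 'a fps"
  have "fps_binomial (-a) oo ?Q = fps_binomial (-(2 * a))"
    using fps_binomial_compose_mult[of fps_X fps_X "-a"]
    by (simp flip: fps_binomial_add_mult)
  moreover have "(fps_binomial (-a) oo ?V) * (fps_binomial (-a) oo ?Q) =
      fps_binomial (-a) oo (?V + ?Q + ?V * ?Q)"
    by (rule fps_binomial_compose_mult) auto
  moreover have "?V + ?Q + ?V * ?Q = fps_const (2 * z) * fps_X + fps_X ^ 2"
  proof -
    have "1 + ?Q = (1 + fps_X) ^ 2" by (simp add: power2_eq_square algebra_simps)
    also have "\<dots> = fps_binomial 2" using fps_binomial_of_nat[of 2, where 'a = 'a] by simp
    finally have "fps_binomial (-2) * (1 + ?Q) = fps_binomial (-2 + 2)"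
      by (simp only: fps_binomial_add_mult)
    then have "fps_const (2 * (z - 1)) * fps_X * (fps_binomial (-2) * (1 + ?Q)) + ?Q =
        fps_const (2 * (z - 1)) * fps_X + ?Q"
      by simp
    moreover have "fps_const (2 * (z - 1)) * fps_X + ?Q = fps_const (2 * z) * fps_X + fps_X ^ 2"
    proof -
      have "fps_const (2 * (z - 1)) = fps_const (2 * z) - 2"
        by (simp add: algebra_simps numeral_fps_const)
      then show ?thesis by (simp add: algebra_simps power2_eq_square)
    qed
    ultimately show ?thesis by (simp add: algebra_simps)
  qed
  ultimately show ?thesis by simp
qed

lemma pochhammer_neg_of_nat:
  "k \<le> n \<Longrightarrow> pochhammer (- of_nat n) k = ((-1) ^ k * fact n / fact (n - k) :: 'a :: field_char_0)"
  using gbinomial_pochhammer[of "of_nat n :: 'a" k]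
  by (simp add: binomial_fact field_simps flip: binomial_gbinomial)

text \<open>
  Both sides are, up to the sign \<open>(-1) ^ n\<close>, the coefficient of \<open>X ^ n\<close> in the generating function
  \<open>(1 + 2 z X + X\<^sup>2) ^ (-\<mu>)\<close>: expanding it in powers of \<open>2 z X + X\<^sup>2\<close> gives the powers of \<open>z\<close>, and
  expanding it after the shift above gives the hypergeometric sum in powers of \<open>1 - z\<close>.
\<close>

theorem gegenbauer_explicit:
  assumes "\<And>k. \<mu> + 1 / 2 \<noteq> - of_nat k"
  shows "gegenbauer n \<mu> z =
    (\<Sum>j\<le>n. (-1) ^ (n - j) * pochhammer \<mu> j / fact j * of_nat (j choose (n - j)) * (2 * z) ^ (2 * j - n))"
proof -
  have nz: "pochhammer (\<mu> + 1 / 2) k \<noteq> 0" for k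
    using assms by (auto simp: pochhammer_eq_0_iff)
  have sgn: "(-1) ^ n * (-1) ^ j = ((-1) ^ (n - j) :: complex)" if "j \<le> n" for j
  proof -
    have "(-1) ^ ((n - j) + j) * (-1) ^ j = ((-1) ^ (n - j) :: complex)"
      unfolding power_add mult.assoc by simp
    then show ?thesis using that by simp
  qed
  have "gegenbauer n \<mu> z = (\<Sum>k\<le>n. (-1) ^ n * ((- \<mu> gchoose k) * (2 * (z - 1)) ^ k *
      ((- (2 * \<mu>) - 2 * of_nat k) gchoose (n - k))))"
    unfolding gegenbauer_def hyp2F1_terminating sum_distrib_left
  proof (rule sum.cong)
    fix k assume "k \<in> {..n}"
    then have k: "k \<le> n" by simp
    have "pochhammer (2 * \<mu>) n * pochhammer (of_nat n + 2 * \<mu>) k = pochhammer (2 * \<mu>) (n + k)"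
      using pochhammer_product'[of "2 * \<mu>" n k] by (simp only: add.commute)
    also have "n + k = 2 * k + (n - k)"
      using k by linarith
    also have "pochhammer (2 * \<mu>) (2 * k + (n - k)) =
        pochhammer (2 * \<mu>) (2 * k) * pochhammer (2 * \<mu> + 2 * of_nat k) (n - k)"
      using pochhammer_product'[of "2 * \<mu>" "2 * k" "n - k"] by simp
    also have "\<dots> = 4 ^ k * pochhammer \<mu> k * pochhammer (\<mu> + 1 / 2) k * pochhammer (2 * \<mu> + 2 * of_nat k) (n - k)"
      using pochhammer_double[of \<mu> k] by (simp add: power_mult)
    finally have P: "pochhammer (of_nat n + 2 * \<mu>) k * pochhammer (2 * \<mu>) n = \<dots>"
      by (simp only: mult.commute)
    have "(-1) * ((1 - z) / 2 * 4) = 2 * (z - 1)" by simp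
    then have z: "(-1) ^ k * (((1 - z) / 2) ^ k * 4 ^ k) = (2 * (z - 1)) ^ k"
      by (simp only: power_mult_distrib[symmetric])
    have "pochhammer (2 * \<mu>) n / fact n *
        (pochhammer (- of_nat n) k * pochhammer (of_nat n + 2 * \<mu>) k / (pochhammer (\<mu> + 1 / 2) k * fact k) *
         ((1 - z) / 2) ^ k) =
       (pochhammer (of_nat n + 2 * \<mu>) k * pochhammer (2 * \<mu>) n) * ((1 - z) / 2) ^ k * (-1) ^ k /
          (pochhammer (\<mu> + 1 / 2) k * fact k * fact (n - k))"
      unfolding pochhammer_neg_of_nat[OF k] by (simp add: field_simps)
    also have "\<dots> = pochhammer \<mu> k * pochhammer (2 * \<mu> + 2 * of_nat k) (n - k) * ((-1) ^ k * (((1 - z) / 2) ^ k * 4 ^ k)) /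
          (fact k * fact (n - k))"
      unfolding P using nz[of k] by (simp add: field_simps)
    also note z
    also have "pochhammer \<mu> k * pochhammer (2 * \<mu> + 2 * of_nat k) (n - k) * (2 * (z - 1)) ^ k / (fact k * fact (n - k)) =
       (-1) ^ n * ((- \<mu> gchoose k) * (2 * (z - 1)) ^ k * ((- (2 * \<mu>) - 2 * of_nat k) gchoose (n - k)))"
    proof -
      have "(-1) ^ n * ((-1) ^ k * (-1) ^ (n - k)) = (1 :: complex)"
        using k by (simp flip: power_add)
      then show ?thesis by (simp add: gbinomial_pochhammer field_simps)
    qed
    finally show "pochhammer (2 * \<mu>) n / fact n *
        (pochhammer (- of_nat n) k * pochhammer (of_nat n + 2 * \<mu>) k / (pochhammer (\<mu> + 1 / 2) k * fact k) *
         ((1 - z) / 2) ^ k) =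
       (-1) ^ n * ((- \<mu> gchoose k) * (2 * (z - 1)) ^ k * ((- (2 * \<mu>) - 2 * of_nat k) gchoose (n - k)))" .
  qed simp
  also have "\<dots> = (-1) ^ n * (fps_binomial (-\<mu>) oo (fps_const (2 * z) * fps_X + fps_X ^ 2)) $ n"
    unfolding fps_binomial_compose_quadratic_shift quadratic_compose_nth by (simp add: sum_distrib_left)
  also have "\<dots> = (\<Sum>j\<le>n. (-1) ^ (n - j) * pochhammer \<mu> j / fact j * of_nat (j choose (n - j)) * (2 * z) ^ (2 * j - n))"
    unfolding fps_binomial_compose_quadratic_nth sum_distrib_left
    by (intro sum.cong refl) (simp add: mult.assoc flip: sgn)
  finally show ?thesis .
qed

section \<open>Moments of the Gegenbauer weight\<close>

lemma has_bochner_integral_Jacobi_weight: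
  fixes a b :: real
  assumes "a > 0" "b > 0"
  shows "has_bochner_integral lborel
    (\<lambda>x. indicator {-1..1} x * ((1 - x) powr (a - 1) * (1 + x) powr (b - 1)))
    (2 powr (a + b - 1) * Beta a b)"
proof -
  have si: "set_integrable lborel {0..1} (\<lambda>t. t powr (b - 1) * (1 - t) powr (a - 1))"
    using assms by (intro integrable_Beta)
  have "(LINT t:{0..1}|lborel. t powr (b - 1) * (1 - t) powr (a - 1)) = Beta b a"
    using set_borel_integral_eq_integral(2)[OF si] has_integral_Beta_real[OF assms(2,1)]
    by (simp add: integral_unique)
  with si have "has_bochner_integral lborel
      (\<lambda>t. indicator {0..1} t * (t powr (b - 1) * (1 - t) powr (a - 1))) (Beta b a)"
    by (simp add: has_bochner_integral_iff set_integrable_def set_lebesgue_integral_def)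
  then have "has_bochner_integral lborel (\<lambda>x. indicator {0..1} (1 / 2 + (1 / 2) * x) *
      ((1 / 2 + (1 / 2) * x) powr (b - 1) * (1 - (1 / 2 + (1 / 2) * x)) powr (a - 1)))
      (Beta b a /\<^sub>R \<bar>1 / 2\<bar>)"
    by (subst (asm) lborel_has_bochner_integral_real_affine_iff[of "1/2" _ _ "1/2"]) simp_all
  then have "has_bochner_integral lborel (\<lambda>x. indicator {0..1} (1 / 2 + x / 2) *
      ((1 / 2 + x / 2) powr (b - 1) * (1 - (1 / 2 + x / 2)) powr (a - 1))) (2 * Beta b a)"
    by (simp add: mult.commute)
  then have "has_bochner_integral lborel (\<lambda>x. 2 powr (a + b - 2) * (indicator {0..1} (1 / 2 + x / 2) *
      ((1 / 2 + x / 2) powr (b - 1) * (1 - (1 / 2 + x / 2)) powr (a - 1))))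
      (2 powr (a + b - 2) * (2 * Beta b a))"
    by (rule has_bochner_integral_mult_right)
  moreover have "2 powr (a + b - 2) * (indicator {0..1} (1 / 2 + x / 2) *
      ((1 / 2 + x / 2) powr (b - 1) * (1 - (1 / 2 + x / 2)) powr (a - 1))) =
      indicator {-1..1} x * ((1 - x) powr (a - 1) * (1 + x) powr (b - 1))" for x :: real
  proof (cases "x \<in> {-1..1}")
    case True
    have ind: "indicator {0..1} (1 / 2 + x / 2) = (1 :: real)" "indicator {-1..1} x = (1 :: real)"
      using True by auto
    have half: "1 - (1 / 2 + x / 2) = (1 - x) / 2" "1 / 2 + x / 2 = (1 + x) / 2"
      by (simp_all add: field_simps)
    have split: "2 powr (a + b - 2) = 2 powr (a - 1) * (2 powr (b - 1) :: real)"
      by (simp flip: powr_add)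
    have "((1 + x) / 2) powr (b - 1) = (1 + x) powr (b - 1) / 2 powr (b - 1)"
      "((1 - x) / 2) powr (a - 1) = (1 - x) powr (a - 1) / 2 powr (a - 1)"
      using True by (auto intro!: powr_divide)
    then show ?thesis unfolding ind half(1) split unfolding half(2) by simp
  next
    case False
    then have "(1 / 2 + x / 2) \<notin> {0..1}" by auto
    with False show ?thesis by simp
  qed
  moreover have "2 powr (a + b - 2) * (2 * Beta b a) = 2 powr (a + b - 1) * Beta a b"
  proof -
    have "2 powr (a + b - 1) = 2 powr (a + b - 2) * (2 powr 1 :: real)"
      by (subst powr_add[symmetric]) simp
    then show ?thesis by (simp add: Beta_commute)
  qed
  ultimately show ?thesis by simp
qed

definition gegenbauer_weight :: "real \<Rightarrow> real \<Rightarrow> real" where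
  "gegenbauer_weight \<mu> x = indicator {-1..1} x * (1 - x\<^sup>2) powr (\<mu> - 1 / 2)"

lemma gegenbauer_weight_moment:
  fixes \<mu> :: real
  assumes "\<mu> > - 1 / 2"
  shows "has_bochner_integral lborel
    (\<lambda>x. gegenbauer_weight \<mu> x * ((1 + x) ^ j * ((1 - x) / 2) ^ k))
    (2 powr (2 * \<mu>) * 2 ^ j * (Beta (\<mu> + 1 / 2) (\<mu> + 1 / 2) *
      (pochhammer (\<mu> + 1 / 2) k * pochhammer (\<mu> + 1 / 2) j) /
      (pochhammer (2 * \<mu> + 1) j * pochhammer (2 * \<mu> + 1 + real j) k)))"
proof -
  define s where "s = \<mu> + 1 / 2"
  have s: "s > 0" using assms by (simp add: s_def)
  have B: "has_bochner_integral lborel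
    (\<lambda>x. indicator {-1..1} x * ((1 - x) powr (s + k - 1) * (1 + x) powr (s + j - 1)) / 2 ^ k)
    (2 powr (s + k + (s + j) - 1) * Beta (s + k) (s + j) / 2 ^ k)"
    using s by (intro has_bochner_integral_divide has_bochner_integral_Jacobi_weight) auto
  have 1: "indicator {-1..1} x * ((1 - x) powr (s + k - 1) * (1 + x) powr (s + j - 1)) / 2 ^ k =
      gegenbauer_weight \<mu> x * ((1 + x) ^ j * ((1 - x) / 2) ^ k)" for x :: real
  proof (cases "-1 < x \<and> x < 1")
    case True
    have f: "1 - x\<^sup>2 = (1 - x) * (1 + x)" by (simp add: power2_eq_square algebra_simps)
    have "(1 - x\<^sup>2) powr (\<mu> - 1 / 2) = (1 - x) powr (s - 1) * (1 + x) powr (s - 1)"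
      using True unfolding f by (simp add: powr_mult s_def)
    moreover have "(1 - x) powr (s + k - 1) = (1 - x) powr (s - 1) * (1 - x) ^ k"
      using True powr_add[of "1 - x" "s - 1" "real k"] by (simp add: powr_realpow algebra_simps)
    moreover have "(1 + x) powr (s + j - 1) = (1 + x) powr (s - 1) * (1 + x) ^ j"
      using True powr_add[of "1 + x" "s - 1" "real j"] by (simp add: powr_realpow algebra_simps)
    ultimately show ?thesis using True by (simp add: gegenbauer_weight_def power_divide)
  next
    case False
    then consider "x = 1" | "x = -1" | "x \<notin> {-1..1}" by fastforce
    then show ?thesis by cases (auto simp: gegenbauer_weight_def)
  qed
  have 2: "2 powr (s + k + (s + j) - 1) * Beta (s + k) (s + j) / 2 ^ k =
    2 powr (2 * \<mu>) * 2 ^ j * (Beta s s * (pochhammer s k * pochhammer s j) /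
      (pochhammer (2 * \<mu> + 1) j * pochhammer (2 * \<mu> + 1 + real j) k))"
  proof -
    have p: "2 powr (s + k + (s + j) - 1) = 2 powr (2 * \<mu>) * 2 ^ j * (2 ^ k :: real)"
      by (simp add: s_def add_ac flip: powr_realpow powr_add)
    have ni: "y \<notin> \<int>\<^sub>\<le>\<^sub>0" if "y > 0" for y :: real using that by (auto elim!: nonpos_Ints_cases)
    have G: "Gamma (y + real i) = pochhammer y i * Gamma y" if "y > 0" for y :: real and i
    proof -
      have "Gamma y \<noteq> 0" using Gamma_real_pos[OF that] by linarith
      then show ?thesis using pochhammer_Gamma[OF ni[OF that], of i] by (simp add: field_simps)
    qed
    have "s + real k + (s + real j) = (2 * \<mu> + 1) + real (j + k)" by (simp add: s_def)
    then have D: "Gamma (s + real k + (s + real j)) = pochhammer (2 * \<mu> + 1) (j + k) * Gamma (s + s)"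
      using G[of "2 * \<mu> + 1" "j + k"] assms by (simp add: s_def algebra_simps)
    have "Beta (s + k) (s + j) = Beta s s * (pochhammer s k * pochhammer s j) / pochhammer (2 * \<mu> + 1) (j + k)"
      unfolding Beta_def D using s by (simp add: G mult_ac)
    then show ?thesis unfolding p by (simp add: pochhammer_product')
  qed
  show ?thesis using B unfolding 1 2 by (simp add: s_def)
qed

text \<open>
  Integrating the hypergeometric sum for \<open>C_n\<close> term by term leaves a terminating series of
  argument one.  The factor \<open>pochhammer (j + 1 - n) n\<close> is \<open>j! / (j - n)!\<close> for \<open>j \<ge> n\<close> and vanishes for
  \<open>j < n\<close>, which is the orthogonality of \<open>C_n\<close> to polynomials of lower degree.
\<close>

lemma gegenbauer_shifted_moment:
  fixes \<mu> :: real
  assumes "\<mu> > - 1 / 2"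
  shows "has_bochner_integral lborel
    (\<lambda>x. of_real (gegenbauer_weight \<mu> x) * gegenbauer n (of_real \<mu>) (of_real x) * of_real ((1 + x) ^ j))
    (pochhammer (2 * of_real \<mu>) n / fact n *
      of_real (2 powr (2 * \<mu>) * Beta (\<mu> + 1 / 2) (\<mu> + 1 / 2)) * 2 ^ j *
      pochhammer (of_real \<mu> + 1 / 2) j * pochhammer (of_nat j + 1 - of_nat n) n /
      pochhammer (2 * of_real \<mu> + 1) (j + n))"
proof -
  define M where "M = complex_of_real \<mu>"
  define c where "c = (\<lambda>k. pochhammer (2 * M) n / fact n *
    (pochhammer (- of_nat n) k * pochhammer (of_nat n + 2 * M) k / (pochhammer (M + 1 / 2) k * fact k)))"
  define m where "m = (\<lambda>k. 2 powr (2 * \<mu>) * 2 ^ j * (Beta (\<mu> + 1 / 2) (\<mu> + 1 / 2) *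
      (pochhammer (\<mu> + 1 / 2) k * pochhammer (\<mu> + 1 / 2) j) /
      (pochhammer (2 * \<mu> + 1) j * pochhammer (2 * \<mu> + 1 + real j) k)))"
  have "has_bochner_integral lborel
      (\<lambda>x. \<Sum>k\<le>n. c k * of_real (gegenbauer_weight \<mu> x * ((1 + x) ^ j * ((1 - x) / 2) ^ k)))
      (\<Sum>k\<le>n. c k * of_real (m k))"
    unfolding m_def
    by (intro has_bochner_integral_sum has_bochner_integral_mult_right has_bochner_integral_of_real
          gegenbauer_weight_moment assms)
  moreover have "(\<Sum>k\<le>n. c k * of_real (gegenbauer_weight \<mu> x * ((1 + x) ^ j * ((1 - x) / 2) ^ k))) =
      of_real (gegenbauer_weight \<mu> x) * gegenbauer n M (of_real x) * of_real ((1 + x) ^ j)" for x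
    unfolding gegenbauer_def hyp2F1_terminating sum_distrib_left sum_distrib_right c_def
    by (intro sum.cong refl) (simp add: mult_ac)
  moreover have "(\<Sum>k\<le>n. c k * of_real (m k)) = pochhammer (2 * M) n / fact n *
      of_real (2 powr (2 * \<mu>) * Beta (\<mu> + 1 / 2) (\<mu> + 1 / 2)) * 2 ^ j *
      pochhammer (M + 1 / 2) j * pochhammer (of_nat j + 1 - of_nat n) n /
      pochhammer (2 * M + 1) (j + n)"
  proof -
    define K where "K = pochhammer (2 * M) n / fact n *
      of_real (2 powr (2 * \<mu>) * Beta (\<mu> + 1 / 2) (\<mu> + 1 / 2)) * 2 ^ j *
      pochhammer (M + 1 / 2) j / pochhammer (2 * M + 1) j"
    have nz: "pochhammer (M + 1 / 2) k \<noteq> 0" for k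
    proof -
      have "pochhammer (\<mu> + 1 / 2) k > 0" using assms by (intro pochhammer_pos) auto
      then have "complex_of_real (pochhammer (\<mu> + 1 / 2) k) \<noteq> 0" by simp
      then show ?thesis by (simp add: M_def flip: pochhammer_of_real)
    qed
    have m: "of_real (m k) = complex_of_real (2 powr (2 * \<mu>)) * 2 ^ j * (of_real (Beta (\<mu> + 1 / 2) (\<mu> + 1 / 2)) *
      (pochhammer (M + 1 / 2) k * pochhammer (M + 1 / 2) j) /
      (pochhammer (2 * M + 1) j * pochhammer (2 * M + 1 + of_nat j) k))" for k
      by (simp add: m_def M_def flip: pochhammer_of_real)
    have "(\<Sum>k\<le>n. c k * of_real (m k)) = (\<Sum>k\<in>{0..n}. K * (pochhammer (of_nat n + 2 * M) k * pochhammer (- of_nat n) k /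
        (of_nat (fact k) * pochhammer (2 * M + 1 + of_nat j) k)))"
      unfolding atMost_atLeast0
    proof (rule sum.cong)
      fix k
      show "c k * of_real (m k) = K * (pochhammer (of_nat n + 2 * M) k * pochhammer (- of_nat n) k /
        (of_nat (fact k) * pochhammer (2 * M + 1 + of_nat j) k))"
        unfolding c_def m K_def using nz[of k] by (simp add: divide_simps)
    qed simp
    also have "\<dots> = K * (pochhammer (2 * M + 1 + of_nat j - (of_nat n + 2 * M)) n / pochhammer (2 * M + 1 + of_nat j) n)"
    proof -
      have "2 * M + 1 + of_nat j \<noteq> - of_nat i" for i
      proof
        assume "2 * M + 1 + of_nat j = - of_nat i"
        then have "Re (2 * M + 1 + of_nat j) = Re (- of_nat i)" by simp
        then show False using assms by (simp add: M_def)
      qed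
      then show ?thesis by (subst sum_distrib_left[symmetric], subst Vandermonde_pochhammer) auto
    qed
    also have "\<dots> = K * (pochhammer (of_nat j + 1 - of_nat n) n / pochhammer (2 * M + 1 + of_nat j) n)"
      by (simp add: algebra_simps)
    finally show ?thesis by (simp add: K_def pochhammer_product')
  qed
  ultimately show ?thesis by (simp add: M_def)
qed

section \<open>Holomorphic dependence of kernel integrals\<close>

text \<open>
  The arguments of \<open>p\<close> and \<open>q\<close> lie in \<open>(-\<pi>/2, \<pi>/2)\<close>, so their sum stays on the principal branch.
\<close>

lemma powr_mult_Re_pos:
  fixes p q b :: complex
  assumes "Re p > 0" "Re q > 0"
  shows "(p * q) powr b = p powr b * q powr b"
proof -
  have "p \<noteq> 0" "q \<noteq> 0" using assms by auto
  moreover have "\<bar>Im (Ln p)\<bar> < pi / 2" "\<bar>Im (Ln q)\<bar> < pi / 2"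
    by (rule Re_Ln_pos_lt_imp[OF assms(1)], rule Re_Ln_pos_lt_imp[OF assms(2)])
  ultimately have "Ln (p * q) = Ln p + Ln q"
    by (intro Ln_times_simple) linarith+
  then show ?thesis using \<open>p \<noteq> 0\<close> \<open>q \<noteq> 0\<close>
    by (simp add: powr_def distrib_left exp_add)
qed

lemma summable_norm_gbinomial:
  fixes a :: complex and r :: real
  assumes "\<bar>r\<bar> < 1"
  shows "summable (\<lambda>n. norm (a gchoose n) * \<bar>r\<bar> ^ n)"
proof -
  have "ereal (norm (of_real \<bar>r\<bar> :: complex)) < conv_radius (\<lambda>n. a gchoose n)"
    using assms by (auto simp: conv_radius_gchoose)
  from abs_summable_in_conv_radius[OF this] show ?thesis
    by (simp add: norm_mult norm_power)
qed

text \<open>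
  The coefficients of \<open>S powr b\<close> as a power series in \<open>\<rho>\<close>; for \<open>b = -\<lambda>\<close> and \<open>x\<close> in \<open>[-1, 1]\<close> they are the
  Gegenbauer polynomials \<open>C_k\<^sup>\<lambda>(x)\<close>.  Written as a Cauchy product they carry an obvious bound that does
  not depend on \<open>x\<close>.
\<close>

definition kernel_coeff :: "complex \<Rightarrow> nat \<Rightarrow> real \<Rightarrow> complex" where
  "kernel_coeff b k x = (\<Sum>i\<le>k.
     ((b gchoose i) * (- (of_real x + \<i> * of_real (sqrt (1 - x\<^sup>2)))) ^ i) *
     ((b gchoose (k - i)) * (- (of_real x - \<i> * of_real (sqrt (1 - x\<^sup>2)))) ^ (k - i)))"

definition kernel_bound :: "complex \<Rightarrow> nat \<Rightarrow> real" where
  "kernel_bound b k = (\<Sum>i\<le>k. norm (b gchoose i) * norm (b gchoose (k - i)))"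

lemma summable_kernel_bound:
  assumes "0 \<le> r" "r < 1"
  shows "summable (\<lambda>k. kernel_bound b k * r ^ k)"
proof -
  let ?a = "\<lambda>i. norm (b gchoose i) * \<bar>r\<bar> ^ i"
  have a: "summable ?a" using assms by (intro summable_norm_gbinomial) auto
  then have "summable (\<lambda>k. \<Sum>i\<le>k. ?a i * ?a (k - i))"
    by (intro summable_Cauchy_product) (simp_all add: abs_mult)
  moreover have "(\<Sum>i\<le>k. ?a i * ?a (k - i)) = kernel_bound b k * r ^ k" for k
    unfolding kernel_bound_def sum_distrib_right
  proof (intro sum.cong refl)
    fix i assume "i \<in> {..k}"
    then have "r ^ i * r ^ (k - i) = r ^ k" by (simp flip: power_add)
    then show "?a i * ?a (k - i) = norm (b gchoose i) * norm (b gchoose (k - i)) * r ^ k"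
      using assms by (simp add: mult_ac) 
  qed
  ultimately show ?thesis by simp
qed

lemma norm_unit_circle_root:
  assumes "x \<in> {-1..1::real}"
  shows "norm (of_real x + \<i> * of_real (sqrt (1 - x\<^sup>2))) = 1"
    "norm (of_real x - \<i> * of_real (sqrt (1 - x\<^sup>2))) = 1"
proof -
  have "x\<^sup>2 \<le> 1" using assms by (simp add: abs_square_le_1 abs_le_iff)
  then show "norm (of_real x + \<i> * of_real (sqrt (1 - x\<^sup>2))) = 1"
    "norm (of_real x - \<i> * of_real (sqrt (1 - x\<^sup>2))) = 1"
    by (simp_all add: cmod_def)
qed

lemma norm_kernel_coeff_le:
  assumes "x \<in> {-1..1}"
  shows "norm (kernel_coeff b k x) \<le> kernel_bound b k"
  unfolding kernel_coeff_def kernel_bound_def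
  by (rule order_trans[OF norm_sum])
     (simp add: norm_mult norm_power norm_minus_cancel norm_unit_circle_root[OF assms] del: minus_add_distrib minus_diff_eq)

lemma kernel_factor:
  assumes "x \<in> {-1..1::real}"
  shows "(1 - \<rho> * (of_real x + \<i> * of_real (sqrt (1 - x\<^sup>2)))) *
    (1 - \<rho> * (of_real x - \<i> * of_real (sqrt (1 - x\<^sup>2)))) = 1 + \<rho>\<^sup>2 - 2 * \<rho> * of_real x"
proof -
  have "x\<^sup>2 \<le> 1" using assms by (simp add: abs_square_le_1 abs_le_iff)
  then have "(complex_of_real (sqrt (1 - x\<^sup>2)))\<^sup>2 = 1 - (of_real x)\<^sup>2"
    by (simp flip: of_real_power)
  then show ?thesis by (simp add: algebra_simps power2_eq_square) (simp add: flip: power2_eq_square distrib_left)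
qed

lemma Re_kernel_factor_pos:
  assumes "norm \<rho> < 1" "norm e = 1"
  shows "Re (1 - \<rho> * e) > 0"
proof -
  have "Re (\<rho> * e) \<le> norm (\<rho> * e)" by (rule complex_Re_le_cmod)
  then show ?thesis using assms by (simp add: norm_mult)
qed

lemma kernel_coeff_sums:
  assumes x: "x \<in> {-1..1}" and \<rho>: "norm \<rho> < 1"
  shows "(\<lambda>k. kernel_coeff b k x * \<rho> ^ k) sums (1 + \<rho>\<^sup>2 - 2 * \<rho> * of_real x) powr b"
proof -
  define e where "e = of_real x + \<i> * of_real (sqrt (1 - x\<^sup>2))"
  define e' where "e' = of_real x - \<i> * of_real (sqrt (1 - x\<^sup>2))"
  have e: "norm e = 1" "norm e' = 1" using norm_unit_circle_root[OF x] by (simp_all add: e_def e'_def)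
  define t where "t = (\<lambda>w i. (b gchoose i) * (- w) ^ i * \<rho> ^ i)"
  have sums: "t w sums (1 - \<rho> * w) powr b" "summable (\<lambda>i. norm (t w i))" if "norm w = 1" for w
  proof -
    have eq: "t w = (\<lambda>i. (b gchoose i) * (- (\<rho> * w)) ^ i)"
      unfolding t_def mult.assoc power_mult_distrib[symmetric] by (simp add: mult.commute)
    show "t w sums (1 - \<rho> * w) powr b"
      unfolding eq using gen_binomial_complex[of "- (\<rho> * w)" b] that \<rho> by (simp add: norm_mult)
    show "summable (\<lambda>i. norm (t w i))"
      using summable_norm_gbinomial[of "norm \<rho>" b] that \<rho> unfolding eq
      by (simp add: norm_mult norm_power)
  qed
  have "(\<lambda>k. \<Sum>i\<le>k. t e i * t e' (k - i)) sums ((\<Sum>i. t e i) * (\<Sum>i. t e' i))"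
    by (intro Cauchy_product_sums sums e)
  moreover have "(\<Sum>i. t e i) * (\<Sum>i. t e' i) = (1 - \<rho> * e) powr b * (1 - \<rho> * e') powr b"
    using sums(1)[OF e(1)] sums(1)[OF e(2)] by (simp add: sums_iff)
  moreover have "\<dots> = (1 + \<rho>\<^sup>2 - 2 * \<rho> * of_real x) powr b"
    using kernel_factor[OF x, of \<rho>] Re_kernel_factor_pos[OF \<rho> e(1)] Re_kernel_factor_pos[OF \<rho> e(2)]
    unfolding e_def e'_def by (subst powr_mult_Re_pos[symmetric]) auto
  moreover have "(\<Sum>i\<le>k. t e i * t e' (k - i)) = kernel_coeff b k x * \<rho> ^ k" for k
    unfolding kernel_coeff_def sum_distrib_right
  proof (intro sum.cong refl)
    fix i assume "i \<in> {..k}"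
    then have "\<rho> ^ k = \<rho> ^ i * \<rho> ^ (k - i)" by (simp flip: power_add)
    then show "t e i * t e' (k - i) = (b gchoose i) * (- (of_real x + \<i> * of_real (sqrt (1 - x\<^sup>2)))) ^ i *
        ((b gchoose (k - i)) * (- (of_real x - \<i> * of_real (sqrt (1 - x\<^sup>2)))) ^ (k - i)) * \<rho> ^ k"
      unfolding t_def e_def e'_def by (simp only: mult_ac)
  qed
  ultimately show ?thesis by simp
qed

text \<open>
  The uniform bound on the coefficients allows the power series in \<open>\<rho>\<close> to be integrated term by term
  against any integrable \<open>u\<close>, so the integral is itself a power series in the whole unit disc.  This
  covers weights that are unbounded at the end points.
\<close>

lemma
  fixes u :: "real \<Rightarrow> complex"
  assumes u: "integrable lborel u" and supp: "\<And>x. x \<notin> {-1..1} \<Longrightarrow> u x = 0"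
  shows integrable_kernel_powr:
      "\<And>\<rho>. norm \<rho> < 1 \<Longrightarrow> integrable lborel (\<lambda>x. u x * (1 + \<rho>\<^sup>2 - 2 * \<rho> * of_real x) powr b)"
    and holomorphic_kernel_integral:
      "(\<lambda>\<rho>. LINT x|lborel. u x * (1 + \<rho>\<^sup>2 - 2 * \<rho> * of_real x) powr b) holomorphic_on ball 0 1"
proof -
  have meas: "(\<lambda>x. u x * kernel_coeff b k x) \<in> borel_measurable lborel" for k
    using borel_measurable_integrable[OF u] unfolding kernel_coeff_def by measurable
  have le: "norm (u x * kernel_coeff b k x) \<le> norm (u x) * kernel_bound b k" for x k
    using norm_kernel_coeff_le[of x b k] supp[of x]
    by (cases "x \<in> {-1..1}") (auto simp: norm_mult intro: mult_left_mono)
  have int: "integrable lborel (\<lambda>x. u x * kernel_coeff b k x)" for k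
  proof (rule Bochner_Integration.integrable_bound[OF _ meas])
    show "integrable lborel (\<lambda>x. norm (u x) * kernel_bound b k)" using u by simp
    show "AE x in lborel. norm (u x * kernel_coeff b k x) \<le> norm (norm (u x) * kernel_bound b k)"
      using le by (intro AE_I2) (metis abs_ge_self order_trans real_norm_def)
  qed
  {
    fix \<rho> :: complex assume \<rho>: "norm \<rho> < 1"
    define f where "f = (\<lambda>k x. u x * kernel_coeff b k x * \<rho> ^ k)"
    have bnd: "norm (f k x) \<le> norm (u x) * (kernel_bound b k * norm \<rho> ^ k)" for k x
      using mult_right_mono[OF le[of x k], of "norm \<rho> ^ k"]
      by (simp add: f_def norm_mult norm_power mult.assoc)
    have sb: "summable (\<lambda>k. kernel_bound b k * norm \<rho> ^ k)"
      using \<rho> by (intro summable_kernel_bound) auto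
    have fint: "integrable lborel (f k)" for k
      unfolding f_def using int by simp
    have fsum: "AE x in lborel. summable (\<lambda>k. norm (f k x))"
      by (intro AE_I2 summable_comparison_test'[OF summable_mult[OF sb]]) (use bnd in auto)
    have fisum: "summable (\<lambda>k. LINT x|lborel. norm (f k x))"
    proof (rule summable_comparison_test'[OF summable_mult[OF sb, of "LINT x|lborel. norm (u x)"]])
      fix k
      have "(LINT x|lborel. norm (f k x)) \<le> (LINT x|lborel. norm (u x) * (kernel_bound b k * norm \<rho> ^ k))"
        using u fint bnd by (intro integral_mono) auto
      then show "norm (LINT x|lborel. norm (f k x)) \<le>
          (LINT x|lborel. norm (u x)) * (kernel_bound b k * norm \<rho> ^ k)"
        by simp
    qed
    have suminf: "(\<Sum>k. f k x) = u x * (1 + \<rho>\<^sup>2 - 2 * \<rho> * of_real x) powr b" for x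
    proof (cases "x \<in> {-1..1}")
      case True
      then show ?thesis
        using sums_mult[OF kernel_coeff_sums[OF True \<rho>, of b], of "u x"]
        by (simp add: f_def sums_iff mult.assoc)
    qed (simp add: f_def supp)
    have "integrable lborel (\<lambda>x. (\<Sum>k. f k x))" by (rule integrable_suminf[OF fint fsum fisum])
    moreover have "(\<lambda>k. integral\<^sup>L lborel (f k)) sums (LINT x|lborel. (\<Sum>k. f k x))"
      by (rule sums_integral[OF fint fsum fisum])
    ultimately have "integrable lborel (\<lambda>x. u x * (1 + \<rho>\<^sup>2 - 2 * \<rho> * of_real x) powr b)"
      "(\<lambda>k. (LINT x|lborel. u x * kernel_coeff b k x) * \<rho> ^ k) sums
        (LINT x|lborel. u x * (1 + \<rho>\<^sup>2 - 2 * \<rho> * of_real x) powr b)"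
      unfolding suminf by (simp_all add: f_def)
  } note main = this
  show "\<And>\<rho>. norm \<rho> < 1 \<Longrightarrow> integrable lborel (\<lambda>x. u x * (1 + \<rho>\<^sup>2 - 2 * \<rho> * of_real x) powr b)"
    by (rule main)
  show "(\<lambda>\<rho>. LINT x|lborel. u x * (1 + \<rho>\<^sup>2 - 2 * \<rho> * of_real x) powr b) holomorphic_on ball 0 1"
    by (rule power_series_holomorphic[where a = "\<lambda>k. LINT x|lborel. u x * kernel_coeff b k x"])
       (use main(2) in simp)
qed

section \<open>The integrand as a combination of kernel powers\<close>

text \<open>
  The coefficients of \<open>C_m\<^sup>\<mu>\<close> in powers of twice the argument.  If \<open>2 j < m\<close>, where the exponent
  \<open>2 j - m\<close> is truncated, the binomial coefficient is zero.
\<close>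

definition gegenbauer_coeff :: "nat \<Rightarrow> complex \<Rightarrow> nat \<Rightarrow> complex" where
  "gegenbauer_coeff m \<mu> j = (-1) ^ (m - j) * pochhammer \<mu> j / fact j * of_nat (j choose (m - j))"

text \<open>
  The principal square root has argument in \<open>(-\<pi>/2, \<pi>/2]\<close>, hence its logarithm is exactly half of
  the logarithm of \<open>s\<close>, even on the negative axis.
\<close>

lemma csqrt_powr:
  assumes "s \<noteq> 0"
  shows "csqrt s powr c = exp (c * Ln s / 2)"
proof -
  have "Ln (csqrt s) = Ln s / 2"
    unfolding csqrt_exp_Ln[OF assms]
    using mpi_less_Im_Ln[OF assms] Im_Ln_le_pi[OF assms] by (intro Ln_exp) auto
  moreover have "csqrt s powr c = exp (c * Ln (csqrt s))"
    using assms by (simp add: powr_def)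
  ultimately show ?thesis by (simp only: times_divide_eq_right)
qed

lemma gegenbauer_over_powr:
  fixes s w \<mu> :: complex
  assumes \<mu>: "\<And>k. \<mu> + 1 / 2 \<noteq> - of_nat k" and s: "s \<noteq> 0"
  shows "1 / csqrt s powr (2 * \<mu> + of_nat m) * gegenbauer m \<mu> (w / csqrt s) =
    (\<Sum>j\<le>m. gegenbauer_coeff m \<mu> j * (2 * w) ^ (2 * j - m) * s powr (- (\<mu> + of_nat j)))"
  unfolding gegenbauer_explicit[OF \<mu>] sum_distrib_left
proof (intro sum.cong refl)
  fix j
  show "1 / csqrt s powr (2 * \<mu> + of_nat m) * ((-1) ^ (m - j) * pochhammer \<mu> j / fact j *
      of_nat (j choose (m - j)) * (2 * (w / csqrt s)) ^ (2 * j - m)) =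
    gegenbauer_coeff m \<mu> j * (2 * w) ^ (2 * j - m) * s powr (- (\<mu> + of_nat j))"
  proof (cases "2 * j < m")
    case True
    then have "j < m - j" by linarith
    then show ?thesis by (simp add: gegenbauer_coeff_def binomial_eq_0)
  next
    case False
    have r: "csqrt s = exp (Ln s / 2)" using s by (rule csqrt_exp_Ln)
    have "1 / csqrt s powr (2 * \<mu> + of_nat m) / csqrt s ^ (2 * j - m) =
        exp (- ((2 * \<mu> + of_nat m) * Ln s / 2) - of_nat (2 * j - m) * (Ln s / 2))"
      unfolding csqrt_powr[OF s] unfolding r
      by (simp only: exp_of_nat_mult[symmetric] exp_diff exp_minus inverse_eq_divide)
    also have "- ((2 * \<mu> + of_nat m) * Ln s / 2) - of_nat (2 * j - m) * (Ln s / 2) = - (\<mu> + of_nat j) * Ln s"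
      using False by (simp add: of_nat_diff field_simps)
    also have "exp \<dots> = s powr (- (\<mu> + of_nat j))"
      using s by (simp add: powr_def)
    finally have e: "1 / csqrt s powr (2 * \<mu> + of_nat m) / csqrt s ^ (2 * j - m) = s powr (- (\<mu> + of_nat j))" .
    show ?thesis
      unfolding e[symmetric] by (simp add: gegenbauer_coeff_def power_divide power_mult_distrib mult_ac)
  qed
qed

lemma gegenbauer_at_1: "gegenbauer m \<mu> 1 = pochhammer (2 * \<mu>) m / fact m"
proof -
  have "hyp2F1 (- of_nat m) b c 0 = (\<Sum>k\<in>{0}. pochhammer (- of_nat m) k * pochhammer b k / (pochhammer c k * fact k) * 0 ^ k)" for b c
    unfolding hyp2F1_terminating by (rule sum.mono_neutral_right) auto
  then show ?thesis by (simp add: gegenbauer_def)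
qed

text \<open>
  The coefficient of \<open>y ^ k\<close> on the right is \<open>pochhammer \<mu> k / k!\<close> times the explicit formula for
  \<open>C_m\<close> with parameter \<open>\<mu> + k\<close> at the argument one, where the hypergeometric form of the polynomial has the
  single term \<open>pochhammer (2 \<mu> + 2 k) m / m!\<close>.
\<close>

lemma gegenbauer_generating_sums:
  fixes y \<mu> :: complex
  assumes \<mu>: "\<And>k. \<mu> + 1 / 2 \<noteq> - of_nat k" and y: "norm y < 1"
  shows "(\<lambda>k. pochhammer \<mu> k * pochhammer (2 * \<mu> + 2 * of_nat k) m / (fact k * fact m) * y ^ k) sums
    (\<Sum>j\<le>m. gegenbauer_coeff m \<mu> j * 2 ^ (2 * j - m) * (1 - y) powr (- (\<mu> + of_nat j)))"
proof -
  have "(\<lambda>k. pochhammer (\<mu> + of_nat j) k / fact k * y ^ k) sums (1 - y) powr (- (\<mu> + of_nat j))" for j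
  proof -
    have "(- (\<mu> + of_nat j) gchoose k) * (- y) ^ k = pochhammer (\<mu> + of_nat j) k / fact k * y ^ k" for k
    proof -
      have "(-1) ^ k * (- y) ^ k = y ^ k" by (simp flip: power_mult_distrib)
      then show ?thesis by (simp add: gbinomial_pochhammer mult_ac del: minus_add_distrib)
    qed
    then show ?thesis using gen_binomial_complex[of "- y" "- (\<mu> + of_nat j)"] y
      by (simp del: minus_add_distrib)
  qed
  then have "(\<lambda>k. \<Sum>j\<le>m. gegenbauer_coeff m \<mu> j * 2 ^ (2 * j - m) * (pochhammer (\<mu> + of_nat j) k / fact k * y ^ k)) sums
    (\<Sum>j\<le>m. gegenbauer_coeff m \<mu> j * 2 ^ (2 * j - m) * (1 - y) powr (- (\<mu> + of_nat j)))"
    by (intro sums_sum sums_mult)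
  moreover have "(\<Sum>j\<le>m. gegenbauer_coeff m \<mu> j * 2 ^ (2 * j - m) * (pochhammer (\<mu> + of_nat j) k / fact k * y ^ k)) =
      pochhammer \<mu> k * pochhammer (2 * \<mu> + 2 * of_nat k) m / (fact k * fact m) * y ^ k" for k
  proof -
    have \<mu>k: "\<mu> + of_nat k + 1 / 2 \<noteq> - of_nat i" for i
    proof
      assume "\<mu> + of_nat k + 1 / 2 = - of_nat i"
      then have "\<mu> + 1 / 2 = - of_nat (k + i)" by (simp add: algebra_simps add_eq_0_iff)
      with \<mu> show False by blast
    qed
    have "(\<Sum>j\<le>m. gegenbauer_coeff m \<mu> j * 2 ^ (2 * j - m) * (pochhammer (\<mu> + of_nat j) k / fact k * y ^ k)) =
        pochhammer \<mu> k / fact k * y ^ k * gegenbauer m (\<mu> + of_nat k) 1"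
      unfolding gegenbauer_explicit[OF \<mu>k] sum_distrib_left
    proof (intro sum.cong refl)
      fix j
      have "pochhammer \<mu> j * pochhammer (\<mu> + of_nat j) k = pochhammer \<mu> k * pochhammer (\<mu> + of_nat k) j"
        using pochhammer_product'[of \<mu> j k] pochhammer_product'[of \<mu> k j] by (simp only: add.commute)
      then show "gegenbauer_coeff m \<mu> j * 2 ^ (2 * j - m) * (pochhammer (\<mu> + of_nat j) k / fact k * y ^ k) =
        pochhammer \<mu> k / fact k * y ^ k * ((-1) ^ (m - j) * pochhammer (\<mu> + of_nat k) j / fact j *
          of_nat (j choose (m - j)) * (2 * 1) ^ (2 * j - m))"
        unfolding gegenbauer_coeff_def by (simp add: field_simps)
    qed
    also have "\<dots> = pochhammer \<mu> k * pochhammer (2 * \<mu> + 2 * of_nat k) m / (fact k * fact m) * y ^ k"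
      by (simp add: gegenbauer_at_1 algebra_simps)
    finally show ?thesis .
  qed
  ultimately show ?thesis by simp
qed

text \<open>
  For positive \<open>r\<close> the factor \<open>(1 + r)\<^sup>2\<close> can be split off from the power, and all terms then carry the
  same power of \<open>1 + r\<close>.
\<close>

lemma kernel_sum_real:
  fixes r x :: real and \<mu> :: complex
  assumes r: "0 < r" "r < 1" and x: "x \<in> {-1..1}"
  defines "y \<equiv> 2 * r * (1 + x) / (1 + r)\<^sup>2"
  shows "(\<Sum>j\<le>m. gegenbauer_coeff m \<mu> j * (2 * (1 + of_real r)) ^ (2 * j - m) *
      (1 + (of_real r)\<^sup>2 - 2 * of_real r * of_real x) powr (- (\<mu> + of_nat j))) =
    (1 + of_real r) powr (- (2 * \<mu> + of_nat m)) *
    (\<Sum>j\<le>m. gegenbauer_coeff m \<mu> j * 2 ^ (2 * j - m) * (1 - of_real y) powr (- (\<mu> + of_nat j)))"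
    and "0 \<le> y" and "y \<le> 4 * r / (1 + r)\<^sup>2" and "4 * r / (1 + r)\<^sup>2 < 1"
proof -
  show "0 \<le> y" "y \<le> 4 * r / (1 + r)\<^sup>2" using r x by (auto simp: y_def divide_right_mono)
  have "0 < (1 - r)\<^sup>2" using r by simp
  then have "4 * r < (1 + r)\<^sup>2" by (simp add: power2_eq_square algebra_simps)
  then show q: "4 * r / (1 + r)\<^sup>2 < 1" using r by (simp add: divide_less_eq)
  with \<open>y \<le> 4 * r / (1 + r)\<^sup>2\<close> have y1: "y < 1" by linarith
  have fac: "1 + (of_real r)\<^sup>2 - 2 * of_real r * of_real x =
      ((1 + of_real r) * (1 + of_real r)) * (1 - complex_of_real y)"
  proof -
    have "1 + r\<^sup>2 - 2 * r * x = ((1 + r) * (1 + r)) * (1 - y)"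
    proof -
      have "y * (1 + r)\<^sup>2 = 2 * r * (1 + x)" using r by (simp add: y_def)
      then show ?thesis by (simp add: power2_eq_square algebra_simps)
    qed
    from arg_cong[OF this, of complex_of_real] show ?thesis by simp
  qed
  define A where "A = (1 + of_real r :: complex)"
  have A: "Re A > 0" "A \<noteq> 0" "Re (A * A) > 0" using r by (auto simp: A_def complex_eq_iff)
  show "(\<Sum>j\<le>m. gegenbauer_coeff m \<mu> j * (2 * (1 + of_real r)) ^ (2 * j - m) *
      (1 + (of_real r)\<^sup>2 - 2 * of_real r * of_real x) powr (- (\<mu> + of_nat j))) =
    (1 + of_real r) powr (- (2 * \<mu> + of_nat m)) *
    (\<Sum>j\<le>m. gegenbauer_coeff m \<mu> j * 2 ^ (2 * j - m) * (1 - of_real y) powr (- (\<mu> + of_nat j)))"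
    unfolding fac sum_distrib_left A_def[symmetric]
  proof (intro sum.cong refl)
    fix j
    show "gegenbauer_coeff m \<mu> j * (2 * A) ^ (2 * j - m) * (A * A * (1 - of_real y)) powr (- (\<mu> + of_nat j)) =
       A powr (- (2 * \<mu> + of_nat m)) * (gegenbauer_coeff m \<mu> j * 2 ^ (2 * j - m) * (1 - of_real y) powr (- (\<mu> + of_nat j)))"
    proof (cases "2 * j < m")
      case True
      then have "j < m - j" by linarith
      then show ?thesis by (simp add: gegenbauer_coeff_def binomial_eq_0)
    next
      case False
      have "A ^ (2 * j - m) = A powr (of_nat (2 * j - m))"
        using A by (simp add: powr_nat')
      then have "A ^ (2 * j - m) * (A powr (- (\<mu> + of_nat j)) * A powr (- (\<mu> + of_nat j))) =
         A powr (of_nat (2 * j - m)) * A powr (- (\<mu> + of_nat j) + - (\<mu> + of_nat j))"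
        by (simp only: powr_add)
      also have "\<dots> = A powr (of_nat (2 * j - m) + (- (\<mu> + of_nat j) + - (\<mu> + of_nat j)))"
        by (simp only: powr_add)
      also have "of_nat (2 * j - m) + (- (\<mu> + of_nat j) + - (\<mu> + of_nat j)) = - (2 * \<mu> + of_nat m)"
        using False by (simp add: of_nat_diff)
      finally have e: "A ^ (2 * j - m) * (A powr (- (\<mu> + of_nat j)) * A powr (- (\<mu> + of_nat j))) = A powr (- (2 * \<mu> + of_nat m))" .
      have "(A * A * (1 - of_real y)) powr (- (\<mu> + of_nat j)) =
         A powr (- (\<mu> + of_nat j)) * A powr (- (\<mu> + of_nat j)) * (1 - of_real y) powr (- (\<mu> + of_nat j))"
        using A y1 powr_mult_Re_pos[OF A(3), of "1 - of_real y"] powr_mult_Re_pos[OF A(1) A(1)] by simp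
      then show ?thesis unfolding e[symmetric] by (simp add: power_mult_distrib mult_ac)
    qed
  qed
qed

section \<open>Pfaff and quadratic transformations\<close>

text \<open>
  The products \<open>pochhammer m k * pochhammer (m + k) (K - k)\<close> collapse to \<open>pochhammer m K\<close>, and the
  remaining sum is evaluated by Vandermonde's identity.  The range \<open>k \<le> m\<close> may be replaced by \<open>k \<le> K\<close>,
  as the terms with \<open>k > K\<close> are zero and, for \<open>m < k \<le> K\<close>, the factor
  \<open>pochhammer (1 - m) k\<close> vanishes if \<open>m > 0\<close>, and \<open>pochhammer m K\<close> does if \<open>m = 0\<close>.
\<close>

lemma pfaff_coefficient:
  fixes m :: nat and c :: complex
  assumes c: "\<And>i. c \<noteq> - of_nat i"
  shows "(\<Sum>k\<le>m. pochhammer (of_nat m) k * pochhammer (1 - of_nat m) k / (pochhammer c k * fact k) * (-1) ^ k *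
      (if K < k then 0 else pochhammer (of_nat m + of_nat k) (K - k) / fact (K - k))) =
    pochhammer (of_nat m) K * pochhammer (c + of_nat m - 1) K / (fact K * pochhammer c K)"
proof -
  define t where "t = (\<lambda>k. pochhammer (of_nat m) k * pochhammer (1 - of_nat m) k / (pochhammer c k * fact k) * (-1) ^ k *
      (if K < k then 0 else pochhammer (of_nat m + of_nat k) (K - k) / (fact (K - k) :: complex)))"
  define v where "v = (\<lambda>k. pochhammer (of_nat m) K / fact K *
     (pochhammer (1 - of_nat m) k * pochhammer (- of_nat K) k / (of_nat (fact k) * pochhammer c k)) :: complex)"
  have tv: "t k = v k" if "k \<le> K" for k
  proof -
    have p: "pochhammer (of_nat m) k * pochhammer (of_nat m + of_nat k) (K - k) = (pochhammer (of_nat m) K :: complex)"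
      using that by (simp add: pochhammer_product[of k K])
    have "t k = (pochhammer (of_nat m) k * pochhammer (of_nat m + of_nat k) (K - k)) *
        pochhammer (1 - of_nat m) k * (-1) ^ k / (pochhammer c k * fact k * fact (K - k))"
      using that by (simp add: t_def mult_ac)
    then show ?thesis unfolding p v_def pochhammer_neg_of_nat[OF that] by (simp add: field_simps)
  qed
  have t0: "t k = 0" if "k > K" for k using that by (simp add: t_def)
  have v0: "v k = 0" if "k > m \<or> k > K" for k
  proof (cases "k > K")
    case True
    then show ?thesis by (simp add: v_def pochhammer_of_nat_eq_0_iff)
  next
    case False
    with that have k: "k > m" "k \<le> K" by auto
    show ?thesis
    proof (cases m)
      case 0
      then show ?thesis using k by (simp add: v_def pochhammer_0_left)
    next
      case (Suc m')
      then have "1 - complex_of_nat m = - of_nat m'" by simp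
      then show ?thesis using k Suc by (simp add: v_def pochhammer_of_nat_eq_0_iff del: of_nat_Suc)
    qed
  qed
  have "(\<Sum>k\<le>m. t k) = (\<Sum>k\<le>m. v k)"
    using tv t0 v0 by (intro sum.cong refl) (metis not_le)
  also have "\<dots> = (\<Sum>k\<in>{0..K}. v k)"
    using v0 by (intro sum.mono_neutral_cong) auto
  also have "\<dots> = pochhammer (of_nat m) K / fact K * (pochhammer (c - (1 - of_nat m)) K / pochhammer c K)"
    unfolding v_def using c by (subst sum_distrib_left[symmetric], subst Vandermonde_pochhammer) auto
  finally show ?thesis by (simp add: t_def algebra_simps)
qed

text \<open>
  A case of the Pfaff transformation, \<open>F(m, c + m - 1; c; \<rho>) =
  (1 - \<rho>) ^ (-m) F(m, 1 - m; c; - \<rho> / (1 - \<rho>))\<close>, where the right-hand side terminates.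
\<close>

lemma pfaff_sums:
  fixes \<rho> c :: complex
  assumes c: "\<And>i. c \<noteq> - of_nat i" and \<rho>: "norm \<rho> < 1"
  shows "(\<lambda>K. pochhammer (of_nat m) K * pochhammer (c + of_nat m - 1) K / (fact K * pochhammer c K) * \<rho> ^ K) sums
    (\<Sum>k\<le>m. pochhammer (of_nat m) k * pochhammer (1 - of_nat m) k / (pochhammer c k * fact k) *
       (- \<rho> / (1 - \<rho>)) ^ k / (1 - \<rho>) ^ m)"
proof -
  have "1 - \<rho> \<noteq> 0" using \<rho> by auto
  have base: "(\<lambda>K. (if K < k then 0 else pochhammer (of_nat m + of_nat k) (K - k) / fact (K - k)) * \<rho> ^ K) sums
     (\<rho> ^ k / (1 - \<rho>) ^ (m + k))" for k
  proof -
    have "(- of_nat (m + k) gchoose i) * (- \<rho>) ^ i = pochhammer (of_nat m + of_nat k) i / fact i * \<rho> ^ i" for i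
    proof -
      have "(-1) ^ i * (- \<rho>) ^ i = \<rho> ^ i" by (simp flip: power_mult_distrib)
      then show ?thesis by (simp add: gbinomial_pochhammer mult_ac del: minus_add_distrib)
    qed
    then have "(\<lambda>i. pochhammer (of_nat m + of_nat k) i / fact i * \<rho> ^ i) sums (1 - \<rho>) powr (- of_nat (m + k))"
      using gen_binomial_complex[of "- \<rho>" "- of_nat (m + k)"] \<rho> by (simp del: minus_add_distrib of_nat_add)
    also have "(1 - \<rho>) powr (- of_nat (m + k)) = 1 / (1 - \<rho>) ^ (m + k)"
      using \<open>1 - \<rho> \<noteq> 0\<close> by (simp add: powr_minus powr_nat' inverse_eq_divide del: of_nat_add)
    finally have "(\<lambda>i. \<rho> ^ k * (pochhammer (of_nat m + of_nat k) i / fact i * \<rho> ^ i)) sums (\<rho> ^ k * (1 / (1 - \<rho>) ^ (m + k)))"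
      by (rule sums_mult)
    then show ?thesis
      by (subst sums_zero_iff_shift[of k, symmetric]) (simp_all add: power_add mult_ac)
  qed
  have "(\<lambda>K. \<Sum>k\<le>m. pochhammer (of_nat m) k * pochhammer (1 - of_nat m) k / (pochhammer c k * fact k) * (-1) ^ k *
      ((if K < k then 0 else pochhammer (of_nat m + of_nat k) (K - k) / fact (K - k)) * \<rho> ^ K)) sums
    (\<Sum>k\<le>m. pochhammer (of_nat m) k * pochhammer (1 - of_nat m) k / (pochhammer c k * fact k) * (-1) ^ k *
      (\<rho> ^ k / (1 - \<rho>) ^ (m + k)))"
    by (intro sums_sum sums_mult base)
  also have "(\<lambda>K. \<Sum>k\<le>m. pochhammer (of_nat m) k * pochhammer (1 - of_nat m) k / (pochhammer c k * fact k) * (-1) ^ k *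
      ((if K < k then 0 else pochhammer (of_nat m + of_nat k) (K - k) / fact (K - k)) * \<rho> ^ K)) =
     (\<lambda>K. pochhammer (of_nat m) K * pochhammer (c + of_nat m - 1) K / (fact K * pochhammer c K) * \<rho> ^ K)"
    by (simp only: pfaff_coefficient[OF c, symmetric] sum_distrib_right mult.assoc)
  also have "(\<Sum>k\<le>m. pochhammer (of_nat m) k * pochhammer (1 - of_nat m) k / (pochhammer c k * fact k) * (-1) ^ k *
      (\<rho> ^ k / (1 - \<rho>) ^ (m + k))) = (\<Sum>k\<le>m. pochhammer (of_nat m) k * pochhammer (1 - of_nat m) k / (pochhammer c k * fact k) *
       (- \<rho> / (1 - \<rho>)) ^ k / (1 - \<rho>) ^ m)"
  proof (intro sum.cong refl)
    fix k
    have "(- \<rho> / (1 - \<rho>)) ^ k / (1 - \<rho>) ^ m = (-1) ^ k * (\<rho> ^ k / (1 - \<rho>) ^ (m + k))"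
      unfolding power_divide power_add using power_mult_distrib[of "-1" \<rho> k] by simp
    then show "pochhammer (of_nat m) k * pochhammer (1 - of_nat m) k / (pochhammer c k * fact k) * (-1) ^ k *
      (\<rho> ^ k / (1 - \<rho>) ^ (m + k)) = pochhammer (of_nat m) k * pochhammer (1 - of_nat m) k / (pochhammer c k * fact k) *
       (- \<rho> / (1 - \<rho>)) ^ k / (1 - \<rho>) ^ m"
      by (simp only: times_divide_eq_right[symmetric] mult.assoc)
  qed
  finally show ?thesis .
qed

text \<open>
  The coefficients of \<open>F(a/2, (a+1)/2; c; 4 w)\<close> in powers of \<open>w\<close>, by the duplication formula for
  the Pochhammer symbol.
\<close>

definition quadratic_coeff :: "complex \<Rightarrow> complex \<Rightarrow> nat \<Rightarrow> complex" where
  "quadratic_coeff a c i = pochhammer a (2 * i) / (fact i * pochhammer c i)"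

lemma quadratic_transformation_coeff:
  fixes a c :: complex
  assumes c: "\<And>i. c \<noteq> - of_nat i"
  shows "(\<Sum>i\<le>k. quadratic_coeff a c i * ((- a - 2 * of_nat i) gchoose (k - i))) =
    pochhammer (a + 1 - c) k * pochhammer a k / (fact k * pochhammer c k)"
proof -
  have "(\<Sum>i\<le>k. quadratic_coeff a c i * ((- a - 2 * of_nat i) gchoose (k - i))) =
    (\<Sum>i\<in>{0..k}. (-1) ^ k * pochhammer a k / fact k *
      (pochhammer (a + of_nat k) i * pochhammer (- of_nat k) i / (of_nat (fact i) * pochhammer c i)))"
    unfolding atMost_atLeast0
  proof (intro sum.cong refl)
    fix i assume "i \<in> {0..k}"
    then have i: "i \<le> k" by simp
    then have "2 * i + (k - i) = k + i" by simp
    then have p: "pochhammer a (2 * i) * pochhammer (a + 2 * of_nat i) (k - i) = pochhammer a k * pochhammer (a + of_nat k) i"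
      using pochhammer_product'[of a "2 * i" "k - i"] pochhammer_product'[of a k i] by (simp add: add.commute)
    have n: "- (- a - 2 * of_nat i) = a + 2 * of_nat i" by simp
    have s: "(-1) ^ (k - i) = ((-1) ^ k * (-1) ^ i :: complex)"
    proof -
      have "(-1) ^ k * (-1) ^ i = ((-1) ^ (k - i + i) * (-1) ^ i :: complex)" using i by simp
      also have "\<dots> = (-1) ^ (k - i)" unfolding power_add mult.assoc by simp
      finally show ?thesis ..
    qed
    have "quadratic_coeff a c i * ((- a - 2 * of_nat i) gchoose (k - i)) =
       (pochhammer a (2 * i) * pochhammer (a + 2 * of_nat i) (k - i)) * (-1) ^ (k - i) / (fact i * pochhammer c i * fact (k - i))"
      unfolding quadratic_coeff_def gbinomial_pochhammer n by simp
    then show "quadratic_coeff a c i * ((- a - 2 * of_nat i) gchoose (k - i)) = (-1) ^ k * pochhammer a k / fact k *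
      (pochhammer (a + of_nat k) i * pochhammer (- of_nat k) i / (of_nat (fact i) * pochhammer c i))"
      unfolding p s pochhammer_neg_of_nat[OF i] by (simp add: field_simps)
  qed
  also have "\<dots> = (-1) ^ k * pochhammer a k / fact k * (pochhammer (c - (a + of_nat k)) k / pochhammer c k)"
    using c by (subst sum_distrib_left[symmetric], subst Vandermonde_pochhammer) auto
  also have "c - (a + of_nat k) = - (a - c + of_nat k)" by simp
  also have "pochhammer (- (a - c + of_nat k)) k = (-1) ^ k * pochhammer (a + 1 - c) k"
    by (subst pochhammer_minus) (simp add: algebra_simps)
  finally show ?thesis by (simp add: mult_ac)
qed

text \<open>
  A quadratic transformation, \<open>(1 + \<rho>) ^ (-a) F(a/2, (a+1)/2; c; 4 \<rho> / (1 + \<rho>)\<^sup>2) = F(a, a + 1 - c; c; \<rho>)\<close>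
  near the origin.  Comparing formal power series avoids the rearrangement of a double series.
\<close>

lemma quadratic_transformation:
  fixes a c :: complex
  assumes c: "\<And>i. c \<noteq> - of_nat i" and R: "fps_conv_radius (Abs_fps (quadratic_coeff a c)) > 0"
  shows "eventually (\<lambda>\<rho>. (1 + \<rho>) powr (- a) * eval_fps (Abs_fps (quadratic_coeff a c)) (\<rho> * (1 + \<rho>) powr (- 2)) =
    (\<Sum>K. pochhammer (a + 1 - c) K * pochhammer a K / (fact K * pochhammer c K) * \<rho> ^ K)) (nhds 0)"
proof -
  let ?E = "Abs_fps (quadratic_coeff a c)"
  let ?G = "fps_const 1 * fps_X * fps_binomial (-2) :: complex fps"
  have "(eval_fps ?E \<circ> (\<lambda>\<rho>. 1 * \<rho> * (1 + \<rho>) powr (- 2))) has_fps_expansion (?E oo ?G)"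
  proof (rule has_fps_expansion_compose[OF eval_fps_has_fps_expansion[OF R]])
    show "(\<lambda>\<rho>. 1 * \<rho> * (1 + \<rho>) powr (- 2)) has_fps_expansion ?G"
      by (intro fps_expansion_intros)
  qed simp
  then have "(\<lambda>\<rho>. (eval_fps ?E \<circ> (\<lambda>\<rho>. 1 * \<rho> * (1 + \<rho>) powr (- 2))) \<rho> * (1 + \<rho>) powr (- a)) has_fps_expansion
      ((?E oo ?G) * fps_binomial (- a))"
    by (intro has_fps_expansion_mult has_fps_expansion_binomial_complex)
  then have "eventually (\<lambda>\<rho>. eval_fps ((?E oo ?G) * fps_binomial (- a)) \<rho> =
      (eval_fps ?E \<circ> (\<lambda>\<rho>. 1 * \<rho> * (1 + \<rho>) powr (- 2))) \<rho> * (1 + \<rho>) powr (- a)) (nhds 0)"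
    unfolding has_fps_expansion_def by blast
  moreover have "((?E oo ?G) * fps_binomial (- a)) $ k =
      pochhammer (a + 1 - c) k * pochhammer a k / (fact k * pochhammer c k)" for k
    unfolding quadratic_compose_nth quadratic_transformation_coeff[OF c, symmetric] by simp
  ultimately show ?thesis
    unfolding eval_fps_def by (elim eventually_mono) (simp add: mult.commute)
qed

section \<open>The integral for real parameter\<close>

definition gegenbauer_density :: "nat \<Rightarrow> real \<Rightarrow> real \<Rightarrow> complex" where
  "gegenbauer_density n \<mu> x = of_real (gegenbauer_weight \<mu> x) * gegenbauer n (of_real \<mu>) (of_real x)"

text \<open>
  The integral divided by \<open>\<rho> ^ n F(a, m; c; \<rho>)\<close>, in the form in which it comes out of the
  moments; it is rewritten with Gamma functions in \<open>moment_constant_eq\<close>.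
\<close>

definition moment_constant :: "nat \<Rightarrow> nat \<Rightarrow> real \<Rightarrow> complex" where
  "moment_constant m n \<mu> = pochhammer (2 * of_real \<mu>) n / fact n *
      of_real (2 powr (2 * \<mu>) * Beta (\<mu> + 1 / 2) (\<mu> + 1 / 2)) *
      (pochhammer (2 * of_real \<mu>) (2 * n + m) / (fact m * pochhammer (2 * of_real \<mu> + 1) (2 * n)))"

lemma gegenbauer_density_moment:
  assumes "\<mu> > - 1 / 2"
  shows "has_bochner_integral lborel (\<lambda>x. gegenbauer_density n \<mu> x * of_real ((1 + x) ^ j))
    (pochhammer (2 * of_real \<mu>) n / fact n *
      of_real (2 powr (2 * \<mu>) * Beta (\<mu> + 1 / 2) (\<mu> + 1 / 2)) * 2 ^ j *
      pochhammer (of_real \<mu> + 1 / 2) j * pochhammer (of_nat j + 1 - of_nat n) n /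
      pochhammer (2 * of_real \<mu> + 1) (j + n))"
  unfolding gegenbauer_density_def by (rule gegenbauer_shifted_moment[OF assms])

lemma integrable_gegenbauer_density:
  assumes "\<mu> > - 1 / 2"
  shows "integrable lborel (gegenbauer_density n \<mu>)"
  using gegenbauer_density_moment[OF assms, of n 0] by (simp add: has_bochner_integral_iff)

lemma gegenbauer_density_eq_0: "x \<notin> {-1..1} \<Longrightarrow> gegenbauer_density n \<mu> x = 0"
  by (simp add: gegenbauer_density_def gegenbauer_weight_def)

lemma integral_moment_sums:
  fixes u :: "real \<Rightarrow> complex" and g :: "nat \<Rightarrow> complex"
  assumes mom: "\<And>k. has_bochner_integral lborel (\<lambda>x. u x * of_real ((1 + x) ^ k)) (V k)"
    and supp: "\<And>x. x \<notin> {-1..1} \<Longrightarrow> u x = 0"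
    and q: "0 \<le> q" and g: "summable (\<lambda>k. norm (g k) * (2 * q) ^ k)"
  shows "(\<lambda>k. g k * of_real q ^ k * V k) sums
    (LINT x|lborel. u x * (\<Sum>k. g k * of_real (q * (1 + x)) ^ k))"
proof -
  have u: "integrable lborel u" using mom[of 0] by (simp add: has_bochner_integral_iff)
  define f where "f = (\<lambda>k x. u x * (g k * of_real (q * (1 + x)) ^ k))"
  have f_eq: "f k = (\<lambda>x. g k * of_real q ^ k * (u x * of_real ((1 + x) ^ k)))" for k
    by (simp add: f_def power_mult_distrib mult_ac)
  have f: "has_bochner_integral lborel (f k) (g k * of_real q ^ k * V k)" for k
    unfolding f_eq by (rule has_bochner_integral_mult_right[OF mom])
  then have fint: "integrable lborel (f k)" "integral\<^sup>L lborel (f k) = g k * of_real q ^ k * V k" for k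
    by (auto simp: has_bochner_integral_iff)
  have bnd: "norm (f k x) \<le> norm (u x) * (norm (g k) * (2 * q) ^ k)" for k x
  proof (cases "x \<in> {-1..1}")
    case True
    then have "0 \<le> q * (1 + x)" "q * (1 + x) \<le> 2 * q" using q by (auto simp: mult.commute[of 2] intro: mult_left_mono)
    then have "\<bar>q * (1 + x)\<bar> ^ k \<le> (2 * q) ^ k" by (intro power_mono) auto
    then show ?thesis
      unfolding f_def norm_mult norm_power norm_of_real by (intro mult_left_mono) auto
  qed (simp add: f_def supp)
  have fsum: "AE x in lborel. summable (\<lambda>k. norm (f k x))"
    by (intro AE_I2 summable_comparison_test'[OF summable_mult[OF g]]) (use bnd in auto)
  have fisum: "summable (\<lambda>k. LINT x|lborel. norm (f k x))"
  proof (rule summable_comparison_test'[OF summable_mult[OF g, of "LINT x|lborel. norm (u x)"]])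
    fix k
    have "(LINT x|lborel. norm (f k x)) \<le> (LINT x|lborel. norm (u x) * (norm (g k) * (2 * q) ^ k))"
      using u fint bnd by (intro integral_mono) auto
    then show "norm (LINT x|lborel. norm (f k x)) \<le>
        (LINT x|lborel. norm (u x)) * (norm (g k) * (2 * q) ^ k)"
      by simp
  qed
  have "(\<lambda>k. integral\<^sup>L lborel (f k)) sums (LINT x|lborel. (\<Sum>k. f k x))"
    by (rule sums_integral[OF fint(1) fsum fisum])
  moreover have "(\<Sum>k. f k x) = u x * (\<Sum>k. g k * of_real (q * (1 + x)) ^ k)" for x
  proof (cases "x \<in> {-1..1}")
    case True
    then have "\<bar>q * (1 + x)\<bar> \<le> 2 * q" using q by (auto simp: abs_mult mult.commute[of 2] intro: mult_left_mono)
    then have "\<bar>q * (1 + x)\<bar> ^ k \<le> (2 * q) ^ k" for k by (intro power_mono) auto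
    then have "norm (g k * of_real (q * (1 + x)) ^ k) \<le> norm (g k) * (2 * q) ^ k" for k
      unfolding norm_mult norm_power norm_of_real by (intro mult_left_mono) auto
    then have "summable (\<lambda>k. g k * of_real (q * (1 + x)) ^ k)"
      by (intro summable_comparison_test'[OF g]) auto
    then show ?thesis unfolding f_def by (rule suminf_mult)
  qed (simp add: f_def supp)
  ultimately show ?thesis unfolding fint(2) by simp
qed

text \<open>
  The moments below order \<open>n\<close> vanish, so the series starts at the index \<open>k = n + i\<close>.  The three
  symbols \<open>pochhammer \<mu> k\<close>, \<open>pochhammer (\<mu> + 1/2) k\<close> and \<open>pochhammer (2 \<mu> + 2 k) m\<close> combine by
  the duplication formula into
  \<open>pochhammer (2 \<mu>) (2 n + m) * pochhammer a (2 i) / 4 ^ k\<close>.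
\<close>

lemma density_integral_sums:
  fixes r \<mu> :: real and m n :: nat
  assumes \<mu>: "\<mu> > - 1 / 2" and r: "0 < r" "r < 1"
  defines "M \<equiv> complex_of_real \<mu>"
  defines "a \<equiv> 2 * M + 2 * of_nat n + of_nat m"
  shows "(\<lambda>i. moment_constant m n \<mu> * of_real r ^ n * ((1 + of_real r) powr (- a) *
      (quadratic_coeff a (2 * M + 2 * of_nat n + 1) i * (of_real r * (1 + of_real r) powr (- 2)) ^ i))) sums
    (LINT x|lborel. gegenbauer_density n \<mu> x *
      (\<Sum>j\<le>m. gegenbauer_coeff m M j * (2 * (1 + of_real r)) ^ (2 * j - m) *
        (1 + (of_real r)\<^sup>2 - 2 * of_real r * of_real x) powr (- (M + of_nat j))))"
proof -
  define A where "A = (1 + of_real r :: complex)"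
  have A: "A \<noteq> 0" "A = of_real (1 + r)" using r by (auto simp: A_def complex_eq_iff)
  have M: "M + 1 / 2 \<noteq> - of_nat k" for k
  proof
    assume "M + 1 / 2 = - of_nat k"
    then have "Re (M + 1 / 2) = Re (- of_nat k)" by simp
    then show False using \<mu> by (simp add: M_def)
  qed
  define g where "g = (\<lambda>k. pochhammer M k * pochhammer (2 * M + 2 * of_nat k) m / (fact k * fact m))"
  define q where "q = 2 * r / (1 + r)\<^sup>2"
  define V where "V = (\<lambda>k. (pochhammer (2 * M) n / fact n *
      of_real (2 powr (2 * \<mu>) * Beta (\<mu> + 1 / 2) (\<mu> + 1 / 2)) * 2 ^ k *
      pochhammer (M + 1 / 2) k * pochhammer (of_nat k + 1 - of_nat n) n /
      pochhammer (2 * M + 1) (k + n)))"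
  have q: "0 \<le> q" "2 * q < 1"
    using r kernel_sum_real(4)[OF r, of 0] by (auto simp: q_def)
  have sg: "summable (\<lambda>k. norm (g k) * (2 * q) ^ k)"
  proof -
    \<comment> \<open>Convergence at some \<open>t > 2 q\<close> gives absolute convergence at \<open>2 q\<close>, the largest value of \<open>y\<close>.\<close>
    obtain t where t: "2 * q < t" "t < 1" using dense[OF q(2)] by blast
    have "summable (\<lambda>k. g k * of_real t ^ k)"
      using gegenbauer_generating_sums[OF M, of "of_real t" m] t q by (auto simp: sums_iff g_def)
    then have "summable (\<lambda>k. norm (g k * of_real (2 * q) ^ k))"
      by (rule powser_insidea) (use t q in auto)
    then show ?thesis using q by (simp add: norm_mult norm_power)
  qed
  have "(\<lambda>k. g k * of_real q ^ k * V k) sums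
    (LINT x|lborel. gegenbauer_density n \<mu> x * (\<Sum>k. g k * of_real (q * (1 + x)) ^ k))"
    unfolding V_def M_def
    by (rule integral_moment_sums[OF gegenbauer_density_moment[OF \<mu>] gegenbauer_density_eq_0 q(1) sg])
  then have "(\<lambda>k. A powr (- (2 * M + of_nat m)) * (g k * of_real q ^ k * V k)) sums
    (A powr (- (2 * M + of_nat m)) * (LINT x|lborel. gegenbauer_density n \<mu> x * (\<Sum>k. g k * of_real (q * (1 + x)) ^ k)))"
    by (rule sums_mult)
  also have "A powr (- (2 * M + of_nat m)) * (LINT x|lborel. gegenbauer_density n \<mu> x * (\<Sum>k. g k * of_real (q * (1 + x)) ^ k)) =
    (LINT x|lborel. gegenbauer_density n \<mu> x *
      (\<Sum>j\<le>m. gegenbauer_coeff m M j * (2 * (1 + of_real r)) ^ (2 * j - m) *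
        (1 + (of_real r)\<^sup>2 - 2 * of_real r * of_real x) powr (- (M + of_nat j))))"
    unfolding integral_mult_right_zero[symmetric]
  proof (intro Bochner_Integration.integral_cong refl)
    fix x :: real
    show "A powr (- (2 * M + of_nat m)) * (gegenbauer_density n \<mu> x * (\<Sum>k. g k * of_real (q * (1 + x)) ^ k)) =
      gegenbauer_density n \<mu> x * (\<Sum>j\<le>m. gegenbauer_coeff m M j * (2 * (1 + of_real r)) ^ (2 * j - m) *
        (1 + (of_real r)\<^sup>2 - 2 * of_real r * of_real x) powr (- (M + of_nat j)))"
    proof (cases "x \<in> {-1..1}")
      case True
      have y: "q * (1 + x) = 2 * r * (1 + x) / (1 + r)\<^sup>2" by (simp add: q_def)
      have "norm (complex_of_real (q * (1 + x))) < 1"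
        unfolding y norm_of_real using kernel_sum_real(2-4)[OF r True] by linarith
      from gegenbauer_generating_sums[OF M this, of m]
      have "(\<Sum>k. g k * of_real (q * (1 + x)) ^ k) =
          (\<Sum>j\<le>m. gegenbauer_coeff m M j * 2 ^ (2 * j - m) * (1 - of_real (q * (1 + x))) powr (- (M + of_nat j)))"
        by (simp add: sums_iff g_def)
      then show ?thesis unfolding kernel_sum_real(1)[OF r True] y A_def by (simp only: mult_ac)
    qed (simp add: gegenbauer_density_eq_0)
  qed
  also have "(\<lambda>k. A powr (- (2 * M + of_nat m)) * (g k * of_real q ^ k * V k)) sums X \<longleftrightarrow>
    (\<lambda>i. A powr (- (2 * M + of_nat m)) * (g (i + n) * of_real q ^ (i + n) * V (i + n))) sums X" for X
  proof (rule sums_zero_iff_shift[symmetric])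
    fix k assume "k < n"
    then have "complex_of_nat k + 1 - of_nat n = - of_nat (n - 1 - k)" by (simp add: of_nat_diff)
    then have "pochhammer (complex_of_nat k + 1 - of_nat n) n = 0"
      using \<open>k < n\<close> by (simp only: pochhammer_of_nat_eq_0_iff)
    then show "A powr (- (2 * M + of_nat m)) * (g k * of_real q ^ k * V k) = 0" by (simp add: V_def)
  qed
  also have "(\<lambda>i. A powr (- (2 * M + of_nat m)) * (g (i + n) * of_real q ^ (i + n) * V (i + n))) =
    (\<lambda>i. moment_constant m n \<mu> * of_real r ^ n * (A powr (- a) *
      (quadratic_coeff a (2 * M + 2 * of_nat n + 1) i * (of_real r * A powr (- 2)) ^ i)))"
  proof
    fix i
    define k where "k = i + n"
    have Am2: "A powr (- 2) = 1 / A ^ 2"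
      using A powr_nat'[of A 2] by (simp add: powr_minus inverse_eq_divide)
    have Aa: "A powr (- (2 * M + of_nat m)) = A powr (- a) * A ^ (2 * n)"
    proof -
      have "A powr (- (2 * M + of_nat m)) = A powr (- a + of_nat (2 * n))"
        by (simp add: a_def)
      then show ?thesis using A by (simp only: powr_add powr_nat' simp_thms)
    qed
    have q_pow: "complex_of_real q ^ k = 2 ^ k * of_real r ^ k / (A ^ (2 * n) * A ^ (2 * i))"
      by (simp add: q_def k_def A power_divide power_mult_distrib power_add power_mult mult_ac power2_eq_square)
    have f1: "pochhammer (of_nat k + 1 - of_nat n) n = fact k / (fact i :: complex)"
    proof -
      have "pochhammer (1 :: complex) (i + n) = pochhammer 1 i * pochhammer (1 + of_nat i) n"
        by (rule pochhammer_product')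
      moreover have "complex_of_nat k + 1 - of_nat n = 1 + of_nat i" by (simp add: k_def)
      ultimately show ?thesis by (simp only: k_def) (simp flip: pochhammer_fact)
    qed
    have f2: "pochhammer M k * pochhammer (M + 1 / 2) k * pochhammer (2 * M + 2 * of_nat k) m * 4 ^ k =
        pochhammer (2 * M) (2 * n + m) * pochhammer a (2 * i)"
    proof -
      have "pochhammer (2 * M) (2 * k + m) = pochhammer (2 * M) (2 * k) * pochhammer (2 * M + 2 * of_nat k) m"
        using pochhammer_product'[of "2 * M" "2 * k" m] by simp
      moreover have "2 * k + m = (2 * n + m) + 2 * i" by (simp add: k_def)
      moreover have "pochhammer (2 * M) ((2 * n + m) + 2 * i) = pochhammer (2 * M) (2 * n + m) * pochhammer a (2 * i)"
        using pochhammer_product'[of "2 * M" "2 * n + m" "2 * i"] by (simp add: a_def add_ac)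
      moreover have "pochhammer (2 * M) (2 * k) = 4 ^ k * pochhammer M k * pochhammer (M + 1 / 2) k"
        using pochhammer_double[of M k] by (simp add: power_mult)
      ultimately show ?thesis by (metis mult.assoc mult.commute)
    qed
    have f3: "pochhammer (2 * M + 1) (k + n) = pochhammer (2 * M + 1) (2 * n) * pochhammer (2 * M + 2 * of_nat n + 1) i"
    proof -
      have "k + n = 2 * n + i" "2 * M + 1 + of_nat (2 * n) = 2 * M + 2 * of_nat n + 1" by (simp_all add: k_def)
      then show ?thesis using pochhammer_product'[of "2 * M + 1" "2 * n" i] by metis
    qed
    define B where "B = complex_of_real (2 powr (2 * \<mu>) * Beta (\<mu> + 1 / 2) (\<mu> + 1 / 2))"
    have "A powr (- (2 * M + of_nat m)) * (g k * of_real q ^ k * V k) =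
      pochhammer (2 * M) n / fact n * B / (fact m * pochhammer (2 * M + 1) (2 * n)) *
      (pochhammer M k * pochhammer (M + 1 / 2) k * pochhammer (2 * M + 2 * of_nat k) m * 4 ^ k) *
      A powr (- a) * of_real r ^ k / (fact i * pochhammer (2 * M + 2 * of_nat n + 1) i * A ^ (2 * i))"
    proof -
      have "(4 :: complex) ^ k = 2 ^ k * 2 ^ k" by (simp flip: power_mult_distrib)
      then show ?thesis
        unfolding Aa q_pow g_def V_def f1 f3 B_def[symmetric] using A(1) by (simp add: mult_ac)
    qed
    also have "\<dots> = moment_constant m n \<mu> * of_real r ^ n * (A powr (- a) *
      (quadratic_coeff a (2 * M + 2 * of_nat n + 1) i * (of_real r * A powr (- 2)) ^ i))"
      unfolding f2 moment_constant_def M_def[symmetric] B_def[symmetric] quadratic_coeff_def Am2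
      by (simp add: k_def power_add power_mult power_divide power_mult_distrib mult_ac power2_eq_square)
    finally show "A powr (- (2 * M + of_nat m)) * (g (i + n) * of_real q ^ (i + n) * V (i + n)) = \<dots>"
      by (simp only: k_def)
  qed
  finally show ?thesis by (simp only: A_def)
qed

section \<open>Analytic continuation and constants\<close>

text \<open>
  The function \<open>(1 - \<rho>) ^ (-m) F(m, 1 - m; c; - \<rho> / (1 - \<rho>))\<close> as a finite sum, which makes its
  holomorphy in the unit disc evident.
\<close>

definition pfaff_polynomial :: "nat \<Rightarrow> complex \<Rightarrow> complex \<Rightarrow> complex" where
  "pfaff_polynomial m c \<rho> = (\<Sum>k\<le>m. pochhammer (of_nat m) k * pochhammer (1 - of_nat m) k / (pochhammer c k * fact k) *
       (- \<rho> / (1 - \<rho>)) ^ k / (1 - \<rho>) ^ m)"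

lemma hyp2F1_m_1_minus_m:
  "hyp2F1 (of_nat m) (1 - of_nat m) c z =
    (\<Sum>k\<le>m. pochhammer (of_nat m) k * pochhammer (1 - of_nat m) k / (pochhammer c k * fact k) * z ^ k)"
proof (cases m)
  case 0
  then show ?thesis using hyp2F1_terminating[of 0 1 c z] by simp
next
  case (Suc k)
  then have eq: "1 - of_nat m = - complex_of_nat k" by simp
  show ?thesis unfolding eq hyp2F1_terminating' by (simp add: Suc pochhammer_of_nat_eq_0_iff del: of_nat_Suc)
qed

lemma moment_constant_nonzero:
  assumes "\<mu> > - 1 / 2" "\<mu> \<noteq> 0"
  shows "moment_constant m n \<mu> \<noteq> 0"
proof -
  have p: "pochhammer (complex_of_real y) k \<noteq> 0" if "y > -1" "y \<noteq> 0" for y k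
  proof
    assume "pochhammer (complex_of_real y) k = 0"
    then obtain i where "complex_of_real y = - of_nat i" by (auto simp: pochhammer_eq_0_iff)
    then have "Re (complex_of_real y) = Re (- of_nat i)" by simp
    then have y: "y = - real i" by simp
    then show False using that by (cases i) auto
  qed
  have "Beta (\<mu> + 1 / 2) (\<mu> + 1 / 2) > 0" using assms by (auto simp: Beta_def intro!: mult_pos_pos divide_pos_pos Gamma_real_pos)
  then show ?thesis
    using p[of "2 * \<mu>" n] p[of "2 * \<mu>" "2 * n + m"] p[of "2 * \<mu> + 1" "2 * n"] assms
    by (simp add: moment_constant_def)
qed

text \<open>
  The quadratic transformation holds in an unspecified neighbourhood of the origin, hence the
  \<open>\<epsilon>\<close>.  That the Gauss series in it has a positive radius of convergence follows from the
  convergence of the moment expansion of the integral.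
\<close>

lemma integral_small_real:
  fixes \<mu> :: real and m n :: nat
  assumes \<mu>: "\<mu> > - 1 / 2" "\<mu> \<noteq> 0"
  defines "M \<equiv> complex_of_real \<mu>"
  shows "\<exists>\<epsilon>>0. \<forall>r. 0 < r \<and> r < \<epsilon> \<longrightarrow> (LINT x|lborel. gegenbauer_density n \<mu> x *
      (\<Sum>j\<le>m. gegenbauer_coeff m M j * (2 * (1 + of_real r)) ^ (2 * j - m) *
        (1 + (of_real r)\<^sup>2 - 2 * of_real r * of_real x) powr (- (M + of_nat j)))) =
    moment_constant m n \<mu> * of_real r ^ n * pfaff_polynomial m (2 * M + 2 * of_nat n + 1) (of_real r)"
proof -
  define a where "a = 2 * M + 2 * of_nat n + of_nat m"
  define c where "c = 2 * M + 2 * of_nat n + 1"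
  define E where "E = Abs_fps (quadratic_coeff a c)"
  define I where "I = (\<lambda>r::real. LINT x|lborel. gegenbauer_density n \<mu> x *
      (\<Sum>j\<le>m. gegenbauer_coeff m M j * (2 * (1 + of_real r)) ^ (2 * j - m) *
        (1 + (of_real r)\<^sup>2 - 2 * of_real r * of_real x) powr (- (M + of_nat j))))"
  have c: "c \<noteq> - of_nat i" for i
  proof
    assume "c = - of_nat i"
    then have "Re c = Re (- of_nat i)" by simp
    then show False using \<mu> by (simp add: c_def M_def)
  qed
  have nz: "moment_constant m n \<mu> \<noteq> 0" by (rule moment_constant_nonzero[OF \<mu>])
  have pnz: "1 + complex_of_real r \<noteq> 0" if "r > 0" for r using that by (auto simp: complex_eq_iff)
  have sums: "(\<lambda>i. moment_constant m n \<mu> * of_real r ^ n * ((1 + of_real r) powr (- a) *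
      (quadratic_coeff a c i * (of_real r * (1 + of_real r) powr (- 2)) ^ i))) sums I r"
    if "0 < r" "r < 1" for r
    unfolding I_def a_def c_def M_def by (rule density_integral_sums[OF \<mu>(1) that])
  have summ: "summable (\<lambda>i. quadratic_coeff a c i * (of_real r * (1 + of_real r) powr (- 2)) ^ i)"
    if "0 < r" "r < 1" for r :: real
  proof -
    have "moment_constant m n \<mu> * of_real r ^ n \<noteq> 0" "(1 + complex_of_real r) powr (- a) \<noteq> 0"
      using nz that pnz[of r] by auto
    then show ?thesis using sums_summable[OF sums[OF that]] by (simp only: summable_cmult_iff simp_thms)
  qed
  \<comment> \<open>Convergence at one nonzero point is known from the integral, as the constant factors are nonzero.\<close>
  have R: "fps_conv_radius E > 0"
  proof -
    define z where "z = complex_of_real (1 / 2) * (1 + of_real (1 / 2)) powr (- 2)"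
    have "conv_radius (quadratic_coeff a c) \<ge> ereal (norm z)"
      using summ[of "1 / 2"] by (intro conv_radius_geI) (simp add: z_def)
    moreover have "z \<noteq> 0" using pnz[of "1/2"] by (simp add: z_def)
    ultimately show ?thesis
      unfolding E_def fps_conv_radius_def by (simp add: fps_nth_Abs_fps) (metis ereal_less(2) less_le_trans zero_less_norm_iff)
  qed
  have I_eq: "I r = moment_constant m n \<mu> * of_real r ^ n *
      ((1 + of_real r) powr (- a) * eval_fps E (of_real r * (1 + of_real r) powr (- 2)))"
    if "0 < r" "r < 1" for r
  proof -
    have "(\<lambda>i. quadratic_coeff a c i * (of_real r * (1 + of_real r) powr (- 2)) ^ i) sums
        eval_fps E (of_real r * (1 + of_real r) powr (- 2))"
      using summ[OF that] by (simp add: eval_fps_def E_def summable_sums)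
    then have "(\<lambda>i. moment_constant m n \<mu> * of_real r ^ n * ((1 + of_real r) powr (- a) *
      (quadratic_coeff a c i * (of_real r * (1 + of_real r) powr (- 2)) ^ i))) sums
      (moment_constant m n \<mu> * of_real r ^ n *
      ((1 + of_real r) powr (- a) * eval_fps E (of_real r * (1 + of_real r) powr (- 2))))"
      by (intro sums_mult)
    with sums[OF that] show ?thesis by (rule sums_unique2)
  qed
  obtain d where d: "d > 0" "\<And>\<rho>. dist \<rho> 0 < d \<Longrightarrow>
      (1 + \<rho>) powr (- a) * eval_fps E (\<rho> * (1 + \<rho>) powr (- 2)) =
      (\<Sum>K. pochhammer (a + 1 - c) K * pochhammer a K / (fact K * pochhammer c K) * \<rho> ^ K)"
    using quadratic_transformation[OF c R[unfolded E_def]] unfolding eventually_nhds_metric E_def by blast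
  have ac: "a + 1 - c = of_nat m" "a = c + of_nat m - 1" by (simp_all add: a_def c_def)
  have "I r = moment_constant m n \<mu> * of_real r ^ n * pfaff_polynomial m c (of_real r)"
    if "0 < r" "r < min d 1" for r
  proof -
    have "(\<Sum>K. pochhammer (a + 1 - c) K * pochhammer a K / (fact K * pochhammer c K) * of_real r ^ K) =
        pfaff_polynomial m c (of_real r)"
      using pfaff_sums[OF c, of "of_real r" m] that unfolding ac(1) pfaff_polynomial_def
      by (simp add: sums_iff flip: ac(2))
    then show ?thesis using I_eq[of r] d(2)[of "of_real r"] that by (simp add: dist_norm)
  qed
  then show ?thesis using d(1) unfolding I_def c_def by (intro exI[of _ "min d 1"]) auto
qed

text \<open>
  Both sides are holomorphic in the unit disc and agree on a real interval with end point zero.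
\<close>

lemma density_integral:
  fixes \<mu> :: real and m n :: nat and \<rho> :: complex
  assumes \<mu>: "\<mu> > - 1 / 2" "\<mu> \<noteq> 0" and \<rho>: "norm \<rho> < 1"
  defines "M \<equiv> complex_of_real \<mu>"
  shows "has_bochner_integral lborel (\<lambda>x. gegenbauer_density n \<mu> x *
      (\<Sum>j\<le>m. gegenbauer_coeff m M j * (2 * (1 + \<rho>)) ^ (2 * j - m) *
        (1 + \<rho>\<^sup>2 - 2 * \<rho> * of_real x) powr (- (M + of_nat j))))
    (moment_constant m n \<mu> * \<rho> ^ n * pfaff_polynomial m (2 * M + 2 * of_nat n + 1) \<rho>)"
proof -
  define u where "u = gegenbauer_density n \<mu>"
  have u: "integrable lborel u" "\<And>x. x \<notin> {-1..1} \<Longrightarrow> u x = 0"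
    unfolding u_def using integrable_gegenbauer_density[OF \<mu>(1)] gegenbauer_density_eq_0 by auto
  define H where "H = (\<lambda>j \<rho>. LINT x|lborel. u x * (1 + \<rho>\<^sup>2 - 2 * \<rho> * of_real x) powr (- (M + of_nat j)))"
  define \<Phi> where "\<Phi> = (\<lambda>\<rho>. \<Sum>j\<le>m. gegenbauer_coeff m M j * (2 * (1 + \<rho>)) ^ (2 * j - m) * H j \<rho>)"
  define \<Psi> where "\<Psi> = (\<lambda>\<rho>. moment_constant m n \<mu> * \<rho> ^ n * pfaff_polynomial m (2 * M + 2 * of_nat n + 1) \<rho>)"
  have has: "has_bochner_integral lborel (\<lambda>x. u x *
      (\<Sum>j\<le>m. gegenbauer_coeff m M j * (2 * (1 + \<rho>)) ^ (2 * j - m) *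
        (1 + \<rho>\<^sup>2 - 2 * \<rho> * of_real x) powr (- (M + of_nat j)))) (\<Phi> \<rho>)" if "norm \<rho> < 1" for \<rho>
  proof -
    have "has_bochner_integral lborel (\<lambda>x. \<Sum>j\<le>m. gegenbauer_coeff m M j * (2 * (1 + \<rho>)) ^ (2 * j - m) *
        (u x * (1 + \<rho>\<^sup>2 - 2 * \<rho> * of_real x) powr (- (M + of_nat j)))) (\<Phi> \<rho>)"
      unfolding \<Phi>_def H_def
      by (intro has_bochner_integral_sum has_bochner_integral_mult_right has_bochner_integral_integrable
            integrable_kernel_powr u that)
    then show ?thesis by (simp only: sum_distrib_left mult_ac)
  qed
  have "H j holomorphic_on ball 0 1" for j
    unfolding H_def by (rule holomorphic_kernel_integral[OF u])
  then have hol\<Phi>: "\<Phi> holomorphic_on ball 0 1"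
    unfolding \<Phi>_def by (intro holomorphic_intros)
  have hol\<Psi>: "\<Psi> holomorphic_on ball 0 1"
    unfolding \<Psi>_def pfaff_polynomial_def by (intro holomorphic_intros) auto
  obtain \<epsilon> where \<epsilon>: "\<epsilon> > 0" "\<And>r. 0 < r \<Longrightarrow> r < \<epsilon> \<Longrightarrow> (LINT x|lborel. u x *
      (\<Sum>j\<le>m. gegenbauer_coeff m M j * (2 * (1 + of_real r)) ^ (2 * j - m) *
        (1 + (of_real r)\<^sup>2 - 2 * of_real r * of_real x) powr (- (M + of_nat j)))) = \<Psi> (of_real r)"
    using integral_small_real[OF \<mu>, of n m] unfolding u_def \<Psi>_def M_def by blast
  define T where "T = complex_of_real ` {0<..<min \<epsilon> 1}"
  have "\<Phi> z - \<Psi> z = 0" if z: "z \<in> T" for z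
  proof -
    obtain r where r: "z = of_real r" "0 < r" "r < \<epsilon>" "r < 1" using z by (auto simp: T_def)
    then show ?thesis using \<epsilon>(2)[of r] has[of z] by (auto simp: has_bochner_integral_iff)
  qed
  moreover have "(0 :: complex) islimpt T"
  proof -
    have "(0 :: real) islimpt {0<..<min \<epsilon> 1}"
      using \<epsilon>(1) by (intro islimpt_greaterThanLessThan1) auto
    then show ?thesis unfolding islimpt_approachable T_def by (auto simp: dist_norm) 
  qed
  moreover have "(\<lambda>z. \<Phi> z - \<Psi> z) holomorphic_on ball 0 1"
    by (intro holomorphic_intros hol\<Phi> hol\<Psi>)
  moreover have "T \<subseteq> ball 0 1" by (auto simp: T_def)
  ultimately have "\<Phi> \<rho> - \<Psi> \<rho> = 0"
    using \<rho> by (intro analytic_continuation[of "\<lambda>z. \<Phi> z - \<Psi> z" "ball 0 1" T 0 \<rho>]) auto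
  then show ?thesis using has[OF \<rho>] unfolding u_def \<Psi>_def by simp
qed

text \<open>
  Everything reduces to \<open>Gamma (\<mu> + 1/2) / Gamma (2 \<mu>) = 2 powr (1 - 2 \<mu>) * sqrt pi / Gamma \<mu>\<close>,
  the duplication formula.  All arguments exceed \<open>-1\<close> and are nonzero, so no pole occurs.
\<close>

lemma moment_constant_eq:
  fixes \<mu> :: real
  assumes \<mu>: "\<mu> > - 1 / 2" "\<mu> \<noteq> 0"
  shows "moment_constant m n \<mu> =
    of_real (2 powr (2 - 2 * \<mu>) * pi * Gamma (2 * \<mu> + real n) * Gamma (2 * \<mu> + 2 * real n + real m)) /
    (fact m * fact n * of_real ((Gamma \<mu>)\<^sup>2) * of_real (Gamma (2 * \<mu> + 2 * real n + 1)))"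
proof -
  have ni: "y \<notin> \<int>\<^sub>\<le>\<^sub>0" if "y > -1" "y \<noteq> 0" for y :: real
  proof
    assume "y \<in> \<int>\<^sub>\<le>\<^sub>0"
    then obtain i where "y = - real i" by (auto elim!: nonpos_Ints_cases')
    then show False using that by (cases i) auto
  qed
  have nz: "Gamma y \<noteq> 0" if "y > -1" "y \<noteq> 0" for y :: real
    using ni[OF that] by (simp add: Gamma_eq_zero_iff)
  have G: "Gamma (y + real i) = pochhammer y i * Gamma y" if "y > -1" "y \<noteq> 0" for y :: real and i
    using pochhammer_Gamma[OF ni[OF that], of i] nz[OF that] by simp
  have dup: "Gamma \<mu> * Gamma (\<mu> + 1 / 2) = 2 powr (1 - 2 * \<mu>) * sqrt pi * Gamma (2 * \<mu>)"
  proof -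
    have "complex_of_real \<mu> \<notin> \<int>\<^sub>\<le>\<^sub>0" "complex_of_real \<mu> + 1 / 2 \<notin> \<int>\<^sub>\<le>\<^sub>0"
      using ni[of \<mu>] ni[of "\<mu> + 1 / 2"] \<mu> of_real_in_nonpos_Ints_iff[of "\<mu> + 1 / 2", where 'a = complex]
      by (auto simp: of_real_in_nonpos_Ints_iff)
    from Gamma_legendre_duplication[OF this]
    have "complex_of_real (Gamma \<mu> * Gamma (\<mu> + 1 / 2)) =
        of_real (exp ((1 - 2 * \<mu>) * ln 2) * sqrt pi * Gamma (2 * \<mu>))"
      by (simp flip: exp_of_real Gamma_complex_of_real)
    then show ?thesis by (simp only: of_real_eq_iff powr_def) simp
  qed
  have "Gamma (\<mu> + 1 / 2) = 2 powr (1 - 2 * \<mu>) * sqrt pi * Gamma (2 * \<mu>) / Gamma \<mu>"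
    using dup nz[of \<mu>] \<mu> by (simp add: field_simps)
  then have half: "Gamma (\<mu> + 1 / 2) * Gamma (\<mu> + 1 / 2) =
      (2 powr (1 - 2 * \<mu>) * 2 powr (1 - 2 * \<mu>)) * pi * (Gamma (2 * \<mu>))\<^sup>2 / (Gamma \<mu>)\<^sup>2"
    by (simp add: power2_eq_square mult_ac)
  have pow: "2 powr (2 * \<mu>) * (2 powr (1 - 2 * \<mu>) * 2 powr (1 - 2 * \<mu>)) = (2 powr (2 - 2 * \<mu>) :: real)"
    by (simp flip: powr_add)
  have g1: "Gamma (2 * \<mu> + real n) = pochhammer (2 * \<mu>) n * Gamma (2 * \<mu>)"
    using \<mu> by (intro G) auto
  have g2: "Gamma (2 * \<mu> + 2 * real n + real m) = pochhammer (2 * \<mu>) (2 * n + m) * Gamma (2 * \<mu>)"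
    using G[of "2 * \<mu>" "2 * n + m"] \<mu> by (simp add: add_ac)
  have g3: "Gamma (2 * \<mu> + 2 * real n + 1) = pochhammer (2 * \<mu> + 1) (2 * n) * Gamma (2 * \<mu> + 1)"
    using G[of "2 * \<mu> + 1" "2 * n"] \<mu> by (simp add: add_ac)
  have nz': "pochhammer (2 * \<mu> + 1) (2 * n) > 0" "Gamma (2 * \<mu> + 1) > 0"
    using \<mu> by (auto intro: pochhammer_pos Gamma_real_pos)
  have "Beta (\<mu> + 1 / 2) (\<mu> + 1 / 2) = Gamma (\<mu> + 1 / 2) * Gamma (\<mu> + 1 / 2) / Gamma (2 * \<mu> + 1)"
    by (simp add: Beta_def)
  then have "pochhammer (2 * \<mu>) n / fact n * (2 powr (2 * \<mu>) * Beta (\<mu> + 1 / 2) (\<mu> + 1 / 2)) *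
      (pochhammer (2 * \<mu>) (2 * n + m) / (fact m * pochhammer (2 * \<mu> + 1) (2 * n))) =
    (2 powr (2 * \<mu>) * (2 powr (1 - 2 * \<mu>) * 2 powr (1 - 2 * \<mu>))) * pi * Gamma (2 * \<mu> + real n) * Gamma (2 * \<mu> + 2 * real n + real m) /
    (fact m * fact n * (Gamma \<mu>)\<^sup>2 * Gamma (2 * \<mu> + 2 * real n + 1))"
    unfolding half g1 g2 g3 using nz' by (simp add: power2_eq_square mult_ac)
  then have "pochhammer (2 * \<mu>) n / fact n * (2 powr (2 * \<mu>) * Beta (\<mu> + 1 / 2) (\<mu> + 1 / 2)) *
      (pochhammer (2 * \<mu>) (2 * n + m) / (fact m * pochhammer (2 * \<mu> + 1) (2 * n))) =
    2 powr (2 - 2 * \<mu>) * pi * Gamma (2 * \<mu> + real n) * Gamma (2 * \<mu> + 2 * real n + real m) /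
    (fact m * fact n * (Gamma \<mu>)\<^sup>2 * Gamma (2 * \<mu> + 2 * real n + 1))"
    unfolding pow .
  moreover have "moment_constant m n \<mu> = of_real (pochhammer (2 * \<mu>) n / fact n * (2 powr (2 * \<mu>) * Beta (\<mu> + 1 / 2) (\<mu> + 1 / 2)) *
      (pochhammer (2 * \<mu>) (2 * n + m) / (fact m * pochhammer (2 * \<mu> + 1) (2 * n))))"
    by (simp add: moment_constant_def flip: pochhammer_of_real)
  ultimately show ?thesis by simp
qed

theorem mainTheorem18:
  fixes m n :: nat and \<mu> :: real and \<rho> :: complex
    and R :: "real \<Rightarrow> complex" and \<zeta> :: "real \<Rightarrow> complex" and f :: "real \<Rightarrow> complex"
  assumes "\<mu> > - 1 / 2" and "\<mu> \<noteq> 0"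
    and "0 < norm \<rho>" and "norm \<rho> < 1" and "\<rho> \<notin> complex_of_real ` {-1<..0}"
  defines "R \<equiv> \<lambda>x. csqrt (1 + \<rho>\<^sup>2 - 2 * \<rho> * of_real x)"
    and "\<zeta> \<equiv> \<lambda>x. (1 + \<rho>) / R x"
    and "f \<equiv> \<lambda>x. of_real ((1 - x\<^sup>2) powr (\<mu> - 1 / 2)) / R x powr of_real (2 * \<mu> + real m) *
                 gegenbauer m (of_real \<mu>) (\<zeta> x) * gegenbauer n (of_real \<mu>) (of_real x)"
  shows "set_integrable lborel {-1..1} f \<and>
    (LINT x:{-1..1}|lborel. f x) =
      of_real (2 powr (2 - 2 * \<mu>) * pi * Gamma (2 * \<mu> + real n) *
               Gamma (2 * \<mu> + 2 * real n + real m)) /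
      (fact m * fact n * of_real ((Gamma \<mu>)\<^sup>2) * \<rho> powr of_real \<mu> * (1 - \<rho>) ^ m) *
      legendre_P (- of_nat m) (- 2 * of_nat n - 2 * of_real \<mu>) ((1 + \<rho>) / (1 - \<rho>))"
proof -
  define M where "M = complex_of_real \<mu>"
  define c where "c = 2 * M + 2 * of_nat n + 1"
  have \<rho>0: "\<rho> \<noteq> 0" "1 - \<rho> \<noteq> 0" using assms(3,4) by auto
  have M: "M + 1 / 2 \<noteq> - of_nat k" for k
  proof
    assume "M + 1 / 2 = - of_nat k"
    then have "Re (M + 1 / 2) = Re (- of_nat k)" by simp
    then show False using assms(1) by (simp add: M_def)
  qed
  have integrand: "indicator {-1..1} x *\<^sub>R f x = gegenbauer_density n \<mu> x *
      (\<Sum>j\<le>m. gegenbauer_coeff m M j * (2 * (1 + \<rho>)) ^ (2 * j - m) *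
        (1 + \<rho>\<^sup>2 - 2 * \<rho> * of_real x) powr (- (M + of_nat j)))" for x
  proof (cases "x \<in> {-1..1}")
    case True
    have S: "1 + \<rho>\<^sup>2 - 2 * \<rho> * of_real x \<noteq> 0"
      unfolding kernel_factor[OF True, symmetric] mult_eq_0_iff
      using Re_kernel_factor_pos[OF assms(4) norm_unit_circle_root(1)[OF True]]
        Re_kernel_factor_pos[OF assms(4) norm_unit_circle_root(2)[OF True]]
      by (metis less_irrefl zero_complex.simps(1))
    show ?thesis
      unfolding gegenbauer_over_powr[OF M S, symmetric] using True
      by (simp add: f_def \<zeta>_def R_def M_def gegenbauer_density_def gegenbauer_weight_def mult_ac)
  qed (simp add: gegenbauer_density_eq_0)
  have I: "has_bochner_integral lborel (\<lambda>x. indicator {-1..1} x *\<^sub>R f x)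
      (moment_constant m n \<mu> * \<rho> ^ n * pfaff_polynomial m c \<rho>)"
    unfolding integrand M_def c_def by (rule density_integral[OF assms(1,2,4)])
  have leg: "legendre_P (- of_nat m) (- 2 * of_nat n - 2 * of_real \<mu>) ((1 + \<rho>) / (1 - \<rho>)) =
      1 / Gamma c * (\<rho> ^ n * \<rho> powr M) *
      (\<Sum>k\<le>m. pochhammer (of_nat m) k * pochhammer (1 - of_nat m) k / (pochhammer c k * fact k) * (- \<rho> / (1 - \<rho>)) ^ k)"
  proof -
    \<comment> \<open>The branch: the argument of the power is \<open>1 / \<rho>\<close>, and \<open>\<rho>\<close> is off the cut of the logarithm.\<close>
    have z: "((1 + \<rho>) / (1 - \<rho>) + 1) / ((1 + \<rho>) / (1 - \<rho>) - 1) = inverse \<rho>"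
      "(1 - (1 + \<rho>) / (1 - \<rho>)) / 2 = - \<rho> / (1 - \<rho>)"
      using \<rho>0 by (simp_all add: field_simps)
    have c: "1 - (- 2 * of_nat n - 2 * of_real \<mu>) = c"
      "(- 2 * of_nat n - 2 * of_real \<mu>) / 2 = - (of_nat n + M)"
      "- (- of_nat m) = (of_nat m :: complex)" "- of_nat m + 1 = 1 - (of_nat m :: complex)"
      by (simp_all add: c_def M_def field_simps)
    have "\<rho> \<notin> \<real>\<^sub>\<le>\<^sub>0"
    proof
      assume "\<rho> \<in> \<real>\<^sub>\<le>\<^sub>0"
      then obtain r where r: "\<rho> = of_real r" "r \<le> 0" by (auto elim!: nonpos_Reals_cases)
      then have "r \<in> {-1<..0}" using assms(4) by auto
      with r(1) assms(5) show False by blast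
    qed
    then have "inverse \<rho> powr (- (of_nat n + M)) = \<rho> powr (of_nat n + M)"
      using \<rho>0 by (simp add: powr_def Ln_inverse algebra_simps)
    also have "\<dots> = \<rho> ^ n * \<rho> powr M"
      using \<rho>0 by (simp add: powr_add powr_nat')
    finally have p: "inverse \<rho> powr (- (of_nat n + M)) = \<rho> ^ n * \<rho> powr M" .
    show ?thesis unfolding legendre_P_def z c p hyp2F1_m_1_minus_m ..
  qed
  have "Gamma c = of_real (Gamma (2 * \<mu> + 2 * real n + 1))"
    by (simp add: c_def M_def flip: Gamma_complex_of_real)
  then have const: "moment_constant m n \<mu> =
    of_real (2 powr (2 - 2 * \<mu>) * pi * Gamma (2 * \<mu> + real n) * Gamma (2 * \<mu> + 2 * real n + real m)) /
    (fact m * fact n * of_real ((Gamma \<mu>)\<^sup>2) * Gamma c)"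
    using moment_constant_eq[OF assms(1,2)] by simp
  have "moment_constant m n \<mu> * \<rho> ^ n * pfaff_polynomial m c \<rho> =
      of_real (2 powr (2 - 2 * \<mu>) * pi * Gamma (2 * \<mu> + real n) *
               Gamma (2 * \<mu> + 2 * real n + real m)) /
      (fact m * fact n * of_real ((Gamma \<mu>)\<^sup>2) * \<rho> powr of_real \<mu> * (1 - \<rho>) ^ m) *
      legendre_P (- of_nat m) (- 2 * of_nat n - 2 * of_real \<mu>) ((1 + \<rho>) / (1 - \<rho>))"
    unfolding leg const pfaff_polynomial_def sum_divide_distrib[symmetric] unfolding M_def[symmetric]
    using \<rho>0 by (simp add: mult_ac)
  then show ?thesis using I
    by (simp add: has_bochner_integral_iff set_integrable_def set_lebesgue_integral_def)
qed

end
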